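(* Let $\mathcal{G}_0=(G_0,m,\varphi,\tau)$ be a $\Gamma$-gain framework. The following statements are equivalent. (i) Every twisted almost periodic flex of $\mathcal{G}_0$ is a translation of $\mathcal{G}_0$. (ii) $\Omega(\mathcal{G}_0)=\Omega_{js}(\tau)$ and every non-zero $\chi$-symmetric flex of $\mathcal{G}_0$ (for any $\chi\in\hat\Gamma$) is a translation of $\mathcal{G}_0$.
   Context: $X$ and $Y$ are finite-dimensional complex Hilbert spaces; $\Gamma$ is a finitely generated discrete abelian group written additively; $\hat\Gamma$ is its dual group of characters $\chi:\Gamma\to\mathbb{T}$. $\mathrm{Isom}(X)$ is the group of affine isometries of $X$ (maps $x\mapsto Ux+b$ with $U$ a linear isometry, $b\in X$). For a group homomorphism $\tau:\Gamma\to\mathrm{Isom}(X)$, $d\tau(\gamma)$ denotes the linear part of $\tau(\gamma)$; $d\tau$ is a unitary representation of $\Gamma$ on $X$. A $\Gamma$-gain framework is a tuple $\mathcal{G}_0=(G_0,m,\varphi,\tau)$ where $G_0=(V_0,E_0)$ is a finite directed multigraph with $V_0\ne\emptyset$ (loops and parallel edges allowed), $m:E_0\to\Gamma$, $e\mapsto m_e$, is any map, $\varphi=(\varphi_e)_{e\in E_0}$ is a family of linear maps $X\to Y$, and $\tau:\Gamma\to\mathrm{Isom}(X)$ is a group homomorphism. The source and range of $e\in E_0$ are denoted $s(e)$ and $r(e)$. For $\chi\in\hat\Gamma$ the orbit matrix is the linear map $O_{\mathcal{G}_0}(\chi):X^{V_0}\to Y^{E_0}$ given by $(O_{\mathcal{G}_0}(\chi)a)_e=\varphi_e\big(a_{s(e)}-\chi(m_e)\,d\tau(m_e)a_{r(e)}\big)$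 for $e\in E_0$. The RUM spectrum is $\Omega(\mathcal{G}_0)=\{\chi\in\hat\Gamma:\ker O_{\mathcal{G}_0}(\chi)\ne\{0\}\}$. Joint spectrum: for a commuting tuple $T=(T_1,\dots,T_n)$ of linear operators on $X$, $\sigma(T)$ is the set of joint eigenvalues, i.e. points $\lambda\in\mathbb{C}^n$ for which there is a non-zero $a\in X$ with $T_ja=\lambda_ja$ for all $j$. If $\mathcal{A}$ is the unital commutative Banach algebra generated by $T_1,\dots,T_n$ in $B(X)$, then for each $\lambda\in\sigma(T)$ there is a unique non-zero multiplicative linear functional $\psi_\lambda:\mathcal{A}\to\mathbb{C}$ with $\lambda=(\psi_\lambda(T_1),\dots,\psi_\lambda(T_n))$. For $T=(d\tau(\gamma_1),\dots,d\tau(\gamma_n))$ whose entries generate the group $d\tau(\Gamma)$ and $\lambda\in\sigma(T)$, put $\chi_\lambda:=\psi_\lambda\circ d\tau\in\hat\Gamma$, and $\Omega_{js}(\tau):=\{\bar\chi_\lambda:\lambda\in\sigma(T)\}$ (the joint spectral points for $\tau$), which does not depend on the choice of generating tuple $T$. For a finite-dimensional complex Hilbert space $Z$, $\ell^\infty(\Gamma,Z)$ is the Banach space of bounded functions $\Gamma\to Z$ with the supremum norm. The gain framework operator $\tilde C(\mathcal{G}_0):\ell^\infty(\Gamma,X^{V_0})\to\ell^\infty(\Gamma,Y^{E_0})$ is $(\tilde C(\mathcal{G}_0)f)(\gamma)=\big(\varphi_e\circ d\tau(-\gamma)(f(\gamma)_{s(e)}-f(\gamma+m_e)_{r(e)})\big)_{e\in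 E_0}$. A bounded infinitesimal flex of $\mathcal{G}_0$ is an $f\in\ell^\infty(\Gamma,X^{V_0})$ with $\tilde C(\mathcal{G}_0)f=0$. The isometric isomorphism $T_{\tilde\tau}$ of $\ell^\infty(\Gamma,X^{V_0})$ is $(T_{\tilde\tau}f)(\gamma)=(d\tau(\gamma)f(\gamma)_v)_{v\in V_0}$. For $\chi\in\hat\Gamma$ and $a\in X^{V_0}$, the $\chi$-symmetric vector $z(\chi,a)$ is $z(\chi,a)(\gamma)=(\chi(\gamma)d\tau(\gamma)a_v)_{v\in V_0}$; a $\chi$-symmetric flex is a $\chi$-symmetric vector which is also a bounded infinitesimal flex. A translation of $\mathcal{G}_0$ is an $f\in\ell^\infty(\Gamma,X^{V_0})$ for which there is $a\in X$ such that, for all $\gamma\in\Gamma$, every component of $f(\gamma)\in X^{V_0}$ equals $a$. $AP(\Gamma,Z)$ (the $Z$-valued almost periodic functions) is the closure in $\ell^\infty(\Gamma,Z)$ of the $Z$-valued trigonometric polynomials $\gamma\mapsto\sum_{k=1}^n\chi_k(\gamma)a_k$ with $\chi_k\in\hat\Gamma$, $a_k\in Z$. A twisted almost periodic flex of $\mathcal{G}_0$ is a function of the form $T_{\tilde\tau}h$ with $h\in AP(\Gamma,X^{V_0})$ which is also a bounded infinitesimal flex of $\mathcal{G}_0$. *)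

theory Defs
  imports
    "HOL-Analysis.Analysis"
    "HOL-Computational_Algebra.Group_Closure"
    "Graph_Theory.Digraph"
begin

section \<open>Finite-dimensional complex Hilbert spaces\<close>

text \<open>The inner product is linear in its second argument. Completeness is automatic in finite
  dimension. The zero space is allowed.\<close>

class fd_complex_hilbert = real_normed_vector +
  fixes scaleC :: "complex \<Rightarrow> 'a \<Rightarrow> 'a"  (infixr \<open>*\<^sub>C\<close> 75)
    and cinner :: "'a \<Rightarrow> 'a \<Rightarrow> complex"
  assumes scaleC_add_right: "c *\<^sub>C (x + y) = c *\<^sub>C x + c *\<^sub>C y"
    and scaleC_add_left: "(c + d) *\<^sub>C x = c *\<^sub>C x + d *\<^sub>C x"
    and scaleC_scaleC: "c *\<^sub>C d *\<^sub>C x = (c * d) *\<^sub>C x"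
    and scaleR_scaleC: "r *\<^sub>R x = complex_of_real r *\<^sub>C x"
    and cinner_commute: "cinner x y = cnj (cinner y x)"
    and cinner_add_right: "cinner x (y + z) = cinner x y + cinner x z"
    and cinner_scaleC_right: "cinner x (c *\<^sub>C y) = c * cinner x y"
    and cinner_self: "cinner x x = complex_of_real ((norm x)\<^sup>2)"
    and finite_dimensional: "\<exists>B. finite B \<and> (\<forall>x. \<exists>c. x = (\<Sum>b\<in>B. c b *\<^sub>C b))"

lemma vector_space_scaleC: "vector_space (scaleC :: complex \<Rightarrow> 'a \<Rightarrow> 'a::fd_complex_hilbert)"
proof
  fix x :: 'a
  show "1 *\<^sub>C x = x" using scaleR_scaleC[of 1 x] by simp
qed (simp_all add: scaleC_add_right scaleC_add_left scaleC_scaleC)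

instantiation complex :: fd_complex_hilbert
begin

definition scaleC_complex :: "complex \<Rightarrow> complex \<Rightarrow> complex" where "scaleC_complex c x = c * x"

definition cinner_complex :: "complex \<Rightarrow> complex \<Rightarrow> complex" where "cinner_complex x y = cnj x * y"

instance
proof
  show "\<exists>B::complex set. finite B \<and> (\<forall>x. \<exists>c. x = (\<Sum>b\<in>B. c b *\<^sub>C b))"
  proof (intro exI conjI allI)
    fix x :: complex
    show "x = (\<Sum>b\<in>{1}. (\<lambda>_. x) b *\<^sub>C b)" by (simp add: scaleC_complex_def)
  qed simp
qed (simp_all add: scaleC_complex_def cinner_complex_def algebra_simps scaleR_conv_of_real
      complex_norm_square[symmetric] mult.commute[of "cnj _"])

end

abbreviation clinear :: "('a::fd_complex_hilbert \<Rightarrow> 'b::fd_complex_hilbert) \<Rightarrow> bool"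
  where "clinear \<equiv> Vector_Spaces.linear scaleC scaleC"

definition affine_isometries :: "('x::fd_complex_hilbert \<Rightarrow> 'x) set"
  where "affine_isometries =
    {\<lambda>x. U x + b | U b. clinear U \<and> (\<forall>x. norm (U x) = norm x)}"

definition linear_part :: "('x::fd_complex_hilbert \<Rightarrow> 'x) \<Rightarrow> 'x \<Rightarrow> 'x"
  where "linear_part T x = T x - T 0"

lemma linear_part_affine:
  assumes "clinear U"
  shows "linear_part (\<lambda>x. U x + b) = U"
proof -
  interpret Vector_Spaces.linear scaleC scaleC U by fact
  show ?thesis by (simp add: linear_part_def fun_eq_iff)
qed

text \<open>The Hilbert space direct sum of copies of a space indexed by the finite set \<open>I\<close>; its elements
  are functions on the whole index type that vanish off \<open>I\<close>.\<close>

definition dsum :: "'i set \<Rightarrow> ('i \<Rightarrow> 'z::fd_complex_hilbert) set"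
  where "dsum I = {a. \<forall>i. i \<notin> I \<longrightarrow> a i = 0}"

definition dsum_norm :: "'i set \<Rightarrow> ('i \<Rightarrow> 'z::fd_complex_hilbert) \<Rightarrow> real"
  where "dsum_norm I a = L2_set (\<lambda>i. norm (a i)) I"


section \<open>Characters and almost periodic functions\<close>

text \<open>The group is discrete, so no continuity is required of characters.\<close>

definition dual_group :: "('g::ab_group_add \<Rightarrow> complex) set"
  where "dual_group = {\<xi>. (\<forall>\<gamma>. norm (\<xi> \<gamma>) = 1) \<and> (\<forall>\<gamma> \<delta>. \<xi> (\<gamma> + \<delta>) = \<xi> \<gamma> * \<xi> \<delta>)}"

definition linfty :: "'i set \<Rightarrow> ('g \<Rightarrow> 'i \<Rightarrow> 'z::fd_complex_hilbert) set"
  where "linfty I = {f. (\<forall>\<gamma>. f \<gamma> \<in> dsum I) \<and> bdd_above (range (\<lambda>\<gamma>. dsum_norm I (f \<gamma>)))}"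

definition linfty_norm :: "'i set \<Rightarrow> ('g \<Rightarrow> 'i \<Rightarrow> 'z::fd_complex_hilbert) \<Rightarrow> real"
  where "linfty_norm I f = (SUP \<gamma>. dsum_norm I (f \<gamma>))"

definition trig_polys :: "'i set \<Rightarrow> ('g::ab_group_add \<Rightarrow> 'i \<Rightarrow> 'z::fd_complex_hilbert) set"
  where "trig_polys I =
    {\<lambda>\<gamma> i. \<Sum>k<n. \<xi> k \<gamma> *\<^sub>C a k i | n \<xi> a. \<forall>k<(n::nat). \<xi> k \<in> dual_group \<and> a k \<in> dsum I}"

definition almost_periodic :: "'i set \<Rightarrow> ('g::ab_group_add \<Rightarrow> 'i \<Rightarrow> 'z::fd_complex_hilbert) set"
  where "almost_periodic I =
    {f \<in> linfty I. \<forall>\<epsilon>>0. \<exists>p\<in>trig_polys I. linfty_norm I (\<lambda>\<gamma> i. f \<gamma> i - p \<gamma> i) < \<epsilon>}"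


section \<open>The joint spectrum\<close>

definition joint_spectrum :: "('x::fd_complex_hilbert \<Rightarrow> 'x) list \<Rightarrow> complex list set"
  where "joint_spectrum Ts = {ls. length ls = length Ts \<and>
    (\<exists>a. a \<noteq> 0 \<and> (\<forall>j<length Ts. (Ts ! j) a = (ls ! j) *\<^sub>C a))}"

inductive_set operator_algebra :: "('x::fd_complex_hilbert \<Rightarrow> 'x) set \<Rightarrow> ('x \<Rightarrow> 'x) set"
  for S :: "('x \<Rightarrow> 'x) set"
  where
    unit: "id \<in> operator_algebra S"
  | gen: "A \<in> S \<Longrightarrow> A \<in> operator_algebra S"
  | add: "A \<in> operator_algebra S \<Longrightarrow> B \<in> operator_algebra S \<Longrightarrow> (\<lambda>x. A x + B x) \<in> operator_algebra S"
  | scale: "A \<in> operator_algebra S \<Longrightarrow> (\<lambda>x. c *\<^sub>C A x) \<in> operator_algebra S"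
  | mult: "A \<in> operator_algebra S \<Longrightarrow> B \<in> operator_algebra S \<Longrightarrow> A \<circ> B \<in> operator_algebra S"

definition banach_algebra_gen :: "('x::fd_complex_hilbert \<Rightarrow> 'x) set \<Rightarrow> ('x \<Rightarrow> 'x) set"
  where "banach_algebra_gen S = {A. clinear A \<and>
    (\<exists>F. (\<forall>n. F n \<in> operator_algebra S) \<and> (\<lambda>n::nat. onorm (\<lambda>x. F n x - A x)) \<longlonglongrightarrow> 0)}"

definition mult_functional :: "('x::fd_complex_hilbert \<Rightarrow> 'x) set \<Rightarrow> (('x \<Rightarrow> 'x) \<Rightarrow> complex) \<Rightarrow> bool"
  where "mult_functional \<A> \<psi> \<longleftrightarrow>
    (\<forall>A\<in>\<A>. \<forall>B\<in>\<A>. \<psi> (\<lambda>x. A x + B x) = \<psi> A + \<psi> B) \<and>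
    (\<forall>A\<in>\<A>. \<forall>c. \<psi> (\<lambda>x. c *\<^sub>C A x) = c * \<psi> A) \<and>
    (\<forall>A\<in>\<A>. \<forall>B\<in>\<A>. \<psi> (A \<circ> B) = \<psi> A * \<psi> B) \<and>
    (\<exists>A\<in>\<A>. \<psi> A \<noteq> 0)"

inductive_set operator_group :: "('x \<Rightarrow> 'x) set \<Rightarrow> ('x \<Rightarrow> 'x) set"
  for S :: "('x \<Rightarrow> 'x) set"
  where
    unit: "id \<in> operator_group S"
  | gen: "A \<in> S \<Longrightarrow> A \<in> operator_group S"
  | mult: "A \<in> operator_group S \<Longrightarrow> B \<in> operator_group S \<Longrightarrow> A \<circ> B \<in> operator_group S"
  | inverse: "A \<in> operator_group S \<Longrightarrow> inv A \<in> operator_group S"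

text \<open>\<open>joint_spectral_points_of\<close> refers to one tuple. Its \<open>\<psi>\<close> is determined by \<open>ls\<close> on the algebra
  generated by the tuple, which contains every \<open>d\<tau> \<gamma>\<close> when the tuple generates. The set does not
  depend on the choice of a generating tuple, so the union over all of them in
  \<open>joint_spectral_points\<close> is the common value.\<close>

definition joint_spectral_points_of ::
    "('g::ab_group_add \<Rightarrow> 'x::fd_complex_hilbert \<Rightarrow> 'x) \<Rightarrow> 'g list \<Rightarrow> ('g \<Rightarrow> complex) set"
  where "joint_spectral_points_of \<tau> \<gamma>s =
    (let Ts = map (\<lambda>\<gamma>. linear_part (\<tau> \<gamma>)) \<gamma>s in
     {\<lambda>\<gamma>. cnj (\<psi> (linear_part (\<tau> \<gamma>))) | \<psi> ls.
        ls \<in> joint_spectrum Ts \<and> mult_functional (banach_algebra_gen (set Ts)) \<psi> \<and>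
        ls = map \<psi> Ts})"

definition joint_spectral_points ::
    "('g::ab_group_add \<Rightarrow> 'x::fd_complex_hilbert \<Rightarrow> 'x) \<Rightarrow> ('g \<Rightarrow> complex) set"
  where "joint_spectral_points \<tau> =
    \<Union> {joint_spectral_points_of \<tau> \<gamma>s | \<gamma>s.
        operator_group (set (map (\<lambda>\<gamma>. linear_part (\<tau> \<gamma>)) \<gamma>s)) = range (\<lambda>\<gamma>. linear_part (\<tau> \<gamma>))}"


section \<open>Gain frameworks\<close>

text \<open>Source and range of an edge are its \<open>tail\<close> and \<open>head\<close>.\<close>

record ('v, 'e, 'g, 'x, 'y) gain_framework =
  graph :: "('v, 'e) pre_digraph"
  gain :: "'e \<Rightarrow> 'g"
  edge_map :: "'e \<Rightarrow> 'x \<Rightarrow> 'y"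
  sym_hom :: "'g \<Rightarrow> 'x \<Rightarrow> 'x"

definition is_gain_framework ::
    "('v, 'e, 'g::ab_group_add, 'x::fd_complex_hilbert, 'y::fd_complex_hilbert) gain_framework \<Rightarrow> bool"
  where "is_gain_framework \<G> \<longleftrightarrow>
    fin_digraph (graph \<G>) \<and> verts (graph \<G>) \<noteq> {} \<and>
    (\<forall>e\<in>arcs (graph \<G>). clinear (edge_map \<G> e)) \<and>
    (\<forall>\<gamma>. sym_hom \<G> \<gamma> \<in> affine_isometries) \<and>
    (\<forall>\<gamma> \<delta>. sym_hom \<G> (\<gamma> + \<delta>) = sym_hom \<G> \<gamma> \<circ> sym_hom \<G> \<delta>)"

abbreviation d_tau :: "('v, 'e, 'g, 'x::fd_complex_hilbert, 'y) gain_framework \<Rightarrow> 'g \<Rightarrow> 'x \<Rightarrow> 'x"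
  where "d_tau \<G> \<gamma> \<equiv> linear_part (sym_hom \<G> \<gamma>)"

definition orbit_matrix ::
    "('v, 'e, 'g, 'x::fd_complex_hilbert, 'y::fd_complex_hilbert) gain_framework \<Rightarrow>
      ('g \<Rightarrow> complex) \<Rightarrow> ('v \<Rightarrow> 'x) \<Rightarrow> 'e \<Rightarrow> 'y"
  where "orbit_matrix \<G> \<xi> a = (\<lambda>e. if e \<in> arcs (graph \<G>)
    then edge_map \<G> e (a (tail (graph \<G>) e)
           - \<xi> (gain \<G> e) *\<^sub>C d_tau \<G> (gain \<G> e) (a (head (graph \<G>) e)))
    else 0)"

definition RUM_spectrum ::
    "('v, 'e, 'g::ab_group_add, 'x::fd_complex_hilbert, 'y::fd_complex_hilbert) gain_framework \<Rightarrow>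
      ('g \<Rightarrow> complex) set"
  where "RUM_spectrum \<G> = {\<xi> \<in> dual_group.
    {a \<in> dsum (verts (graph \<G>)). orbit_matrix \<G> \<xi> a = (\<lambda>_. 0)} \<noteq> {\<lambda>_. 0}}"

definition gain_op ::
    "('v, 'e, 'g::ab_group_add, 'x::fd_complex_hilbert, 'y::fd_complex_hilbert) gain_framework \<Rightarrow>
      ('g \<Rightarrow> 'v \<Rightarrow> 'x) \<Rightarrow> 'g \<Rightarrow> 'e \<Rightarrow> 'y"
  where "gain_op \<G> f = (\<lambda>\<gamma> e. if e \<in> arcs (graph \<G>)
    then edge_map \<G> e (d_tau \<G> (- \<gamma>)
           (f \<gamma> (tail (graph \<G>) e) - f (\<gamma> + gain \<G> e) (head (graph \<G>) e)))
    else 0)"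

definition bounded_flex ::
    "('v, 'e, 'g::ab_group_add, 'x::fd_complex_hilbert, 'y::fd_complex_hilbert) gain_framework \<Rightarrow>
      ('g \<Rightarrow> 'v \<Rightarrow> 'x) \<Rightarrow> bool"
  where "bounded_flex \<G> f \<longleftrightarrow> f \<in> linfty (verts (graph \<G>)) \<and> gain_op \<G> f = (\<lambda>_ _. 0)"

definition twist ::
    "('v, 'e, 'g, 'x::fd_complex_hilbert, 'y) gain_framework \<Rightarrow> ('g \<Rightarrow> 'v \<Rightarrow> 'x) \<Rightarrow> 'g \<Rightarrow> 'v \<Rightarrow> 'x"
  where "twist \<G> f = (\<lambda>\<gamma> v. d_tau \<G> \<gamma> (f \<gamma> v))"

definition sym_vector ::
    "('v, 'e, 'g, 'x::fd_complex_hilbert, 'y) gain_framework \<Rightarrow>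
      ('g \<Rightarrow> complex) \<Rightarrow> ('v \<Rightarrow> 'x) \<Rightarrow> 'g \<Rightarrow> 'v \<Rightarrow> 'x"
  where "sym_vector \<G> \<xi> a = (\<lambda>\<gamma> v. \<xi> \<gamma> *\<^sub>C d_tau \<G> \<gamma> (a v))"

definition sym_flex ::
    "('v, 'e, 'g::ab_group_add, 'x::fd_complex_hilbert, 'y::fd_complex_hilbert) gain_framework \<Rightarrow>
      ('g \<Rightarrow> complex) \<Rightarrow> ('g \<Rightarrow> 'v \<Rightarrow> 'x) \<Rightarrow> bool"
  where "sym_flex \<G> \<xi> f \<longleftrightarrow>
    (\<exists>a\<in>dsum (verts (graph \<G>)). f = sym_vector \<G> \<xi> a) \<and> bounded_flex \<G> f"

definition is_translation ::
    "('v, 'e, 'g, 'x::fd_complex_hilbert, 'y) gain_framework \<Rightarrow> ('g \<Rightarrow> 'v \<Rightarrow> 'x) \<Rightarrow> bool"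
  where "is_translation \<G> f \<longleftrightarrow> f \<in> linfty (verts (graph \<G>)) \<and>
    (\<exists>a. \<forall>\<gamma>. \<forall>v\<in>verts (graph \<G>). f \<gamma> v = a)"

definition twisted_ap_flex ::
    "('v, 'e, 'g::ab_group_add, 'x::fd_complex_hilbert, 'y::fd_complex_hilbert) gain_framework \<Rightarrow>
      ('g \<Rightarrow> 'v \<Rightarrow> 'x) \<Rightarrow> bool"
  where "twisted_ap_flex \<G> f \<longleftrightarrow>
    (\<exists>h\<in>almost_periodic (verts (graph \<G>)). f = twist \<G> h) \<and> bounded_flex \<G> f"

end

theory Submission
  imports Defs "HOL-Library.Function_Algebras"
begin

text \<open>A function \<open>twist h\<close> is a flex exactly when \<open>h\<close> satisfies an equation that is invariant under
  translation by the group, so each Fourier coefficient \<open>a\<close> of an almost periodic solution \<open>h\<close> at a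
  character \<open>\<xi>\<close> lies in the kernel of the orbit matrix at \<open>\<xi>\<close> and yields a \<open>\<xi>\<close>-symmetric flex. If
  these flexes are translations, then \<open>twist h\<close> has the Fourier coefficients of a translation, and
  it is one by uniqueness of Fourier coefficients. Conversely, a \<open>\<xi>\<close>-symmetric flex is itself twisted
  almost periodic, and it is a non-zero translation precisely when its value \<open>b\<close> satisfies
  \<open>\<xi> \<gamma> *\<^sub>C d\<tau> \<gamma> b = b\<close> for all \<open>\<gamma>\<close>. Such \<open>b\<close> exist exactly for the joint spectral points \<open>\<xi>\<close>.
  The mean defining Fourier coefficients is the limit of averages over boxes in the generators.\<close>

section \<open>Inner products and linear maps\<close>

text \<open>The analytic core is uniqueness of Fourier coefficients, proved without passing to the
  Bohr compactification. If all coefficients of \<open>g\<close> vanish, approximation by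
  trigonometric polynomials shows that the squared norm of \<open>g\<close> has mean zero. That the
  mean detects a non-zero value is a total boundedness argument: finitely many translates of
  \<open>g\<close> suffice to have, at every group element, at least one of them large. Relations
  between the generators may make a box hit elements repeatedly. This does no harm: existence and
  translation invariance of the mean are checked on characters, where a box average is a product of
  geometric averages, and then pass to uniform limits. On the spectral side the obstacle is that a
  tuple generates the operators as a group, whereas a multiplicative functional is controlled on an
  algebra built from sums, scalar multiples and products. A linear relation between the powers of an
  operator brings its inverse into that algebra.\<close>

lemma cinner_add_left: "cinner (x + y) z = cinner x z + cinner y z"
  for x y z :: "'a::fd_complex_hilbert"
  by (metis cinner_commute cinner_add_right complex_cnj_add)

lemma cinner_scaleC_left: "cinner (c *\<^sub>C x) y = cnj c * cinner x y"
  for x y :: "'a::fd_complex_hilbert"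
  by (metis cinner_commute cinner_scaleC_right complex_cnj_mult)

lemma cinner_zero_right [simp]: "cinner x 0 = 0" for x :: "'a::fd_complex_hilbert"
  using cinner_add_right[of x 0 0] by simp

lemma cinner_zero_left [simp]: "cinner 0 x = 0" for x :: "'a::fd_complex_hilbert"
  using cinner_add_left[of 0 0 x] by simp

lemma cinner_diff_right: "cinner x (y - z) = cinner x y - cinner x z"
  for x y z :: "'a::fd_complex_hilbert"
  using cinner_add_right[of x "y - z" z] by simp

lemma cinner_sum_right: "cinner x (\<Sum>i\<in>I. f i) = (\<Sum>i\<in>I. cinner x (f i))"
  for x :: "'a::fd_complex_hilbert"
  by (induction I rule: infinite_finite_induct) (simp_all add: cinner_add_right)

global_interpretation scaleC: vector_space "scaleC :: complex \<Rightarrow> 'a \<Rightarrow> 'a::fd_complex_hilbert"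
  by (rule vector_space_scaleC)

text \<open>The class postulates homogeneity of the norm for real scalars only; the complex case is
  read off from \<open>cinner_self\<close>.\<close>

lemma norm_scaleC: "norm (c *\<^sub>C x) = norm c * norm x" for x :: "'a::fd_complex_hilbert"
proof -
  have "complex_of_real ((norm (c *\<^sub>C x))\<^sup>2) = c * cnj c * complex_of_real ((norm x)\<^sup>2)"
    unfolding cinner_self[symmetric] by (simp add: cinner_scaleC_left cinner_scaleC_right)
  also have "\<dots> = complex_of_real ((norm c * norm x)\<^sup>2)"
    by (simp add: power_mult_distrib complex_norm_square[symmetric] del: of_real_power flip: of_real_mult)
  finally have "(norm (c *\<^sub>C x))\<^sup>2 = (norm c * norm x)\<^sup>2"
    by (simp only: of_real_eq_iff)
  then show ?thesis by simp
qed

text \<open>The usual order is reversed: the triangle inequality is an axiom here, and expanding the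
  squared norm of \<open>x + y\<close> turns it into the real part of Cauchy-Schwarz.\<close>

lemma Re_cinner_le: "Re (cinner x y) \<le> norm x * norm y" for x y :: "'a::fd_complex_hilbert"
proof -
  have "complex_of_real ((norm (x + y))\<^sup>2)
      = complex_of_real ((norm x)\<^sup>2) + complex_of_real ((norm y)\<^sup>2) + (cinner x y + cnj (cinner x y))"
    unfolding cinner_self[symmetric] cinner_commute[of y x, symmetric]
    by (simp add: cinner_add_left cinner_add_right)
  then have "Re (complex_of_real ((norm (x + y))\<^sup>2)) =
      Re (complex_of_real ((norm x)\<^sup>2) + complex_of_real ((norm y)\<^sup>2) + (cinner x y + cnj (cinner x y)))"
    by (rule arg_cong)
  then have "(norm (x + y))\<^sup>2 = (norm x)\<^sup>2 + (norm y)\<^sup>2 + 2 * Re (cinner x y)"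
    by simp
  moreover have "(norm (x + y))\<^sup>2 \<le> (norm x + norm y)\<^sup>2"
    by (intro power_mono norm_triangle_ineq norm_ge_zero)
  ultimately show ?thesis by (simp add: power2_sum)
qed

lemma norm_cinner_le: "norm (cinner x y) \<le> norm x * norm y" for x y :: "'a::fd_complex_hilbert"
proof (cases "cinner x y = 0")
  case False
  \<comment> \<open>Rotating \<open>y\<close> by the conjugate phase makes the inner product real
    and non-negative, so the bound on real parts applies to its modulus.\<close>
  define c where "c = cnj (sgn (cinner x y))"
  have "norm c = 1" using False by (simp add: c_def norm_sgn)
  moreover have "cinner x (c *\<^sub>C y) = norm (cinner x y)"
    using False by (simp add: cinner_scaleC_right c_def sgn_eq complex_norm_square[symmetric]
        power2_eq_square mult.commute[of "cnj _"])
  ultimately show ?thesis using Re_cinner_le[of x "c *\<^sub>C y"] by (simp add: norm_scaleC)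
qed simp

lemma bounded_linear_cinner_right: "bounded_linear (cinner x)" for x :: "'a::fd_complex_hilbert"
proof
  show "\<exists>K. \<forall>y. norm (cinner x y) \<le> norm y * K"
    using norm_cinner_le[of x] by (metis mult.commute)
qed (simp_all add: cinner_add_right scaleR_scaleC cinner_scaleC_right scaleC_complex_def)

lemma bounded_linear_scaleC_left: "bounded_linear (\<lambda>c. c *\<^sub>C x)" for x :: "'a::fd_complex_hilbert"
proof
  show "\<exists>K. \<forall>c. norm (c *\<^sub>C x) \<le> norm c * K"
    by (metis norm_scaleC order_refl)
qed (simp_all add: scaleC_add_left scaleR_scaleC scaleC_scaleC scaleC_complex_def)

text \<open>Gram-Schmidt. Spanning is expressed by the expansion formula on \<open>B\<close>; being
  linear in \<open>b\<close>, the formula extends to everything that \<open>B\<close> spans. The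
  remainder \<open>r\<close> of the new vector is either zero or, normalised, the next basis
  vector.\<close>

lemma orthonormal_extension:
  fixes B :: "'a::fd_complex_hilbert set"
  assumes "finite B"
  shows "\<exists>E. finite E \<and> (\<forall>e\<in>E. \<forall>f\<in>E. cinner e f = (if e = f then 1 else 0)) \<and>
    (\<forall>b\<in>B. b = (\<Sum>e\<in>E. cinner e b *\<^sub>C e))"
  using assms
proof (induction B)
  case empty
  then show ?case by (intro exI[of _ "{}"]) simp
next
  case (insert b B)
  then obtain E where E: "finite E" "\<And>e f. e \<in> E \<Longrightarrow> f \<in> E \<Longrightarrow> cinner e f = (if e = f then 1 else 0)"
    and B: "\<And>b. b \<in> B \<Longrightarrow> b = (\<Sum>e\<in>E. cinner e b *\<^sub>C e)"
    by metis
  define r where "r = b - (\<Sum>e\<in>E. cinner e b *\<^sub>C e)"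
  show ?case
  proof (cases "r = 0")
    case True
    then show ?thesis using E B by (intro exI[of _ E]) (auto simp: r_def)
  next
    case False
    define e' where "e' = complex_of_real (1 / norm r) *\<^sub>C r"
    have "cinner e r = 0" if "e \<in> E" for e
    proof -
      have "cinner e (\<Sum>f\<in>E. cinner f b *\<^sub>C f) = (\<Sum>f\<in>E. if f = e then cinner e b else 0)"
        unfolding cinner_sum_right by (rule sum.cong) (auto simp: cinner_scaleC_right E that)
      then show ?thesis using E(1) that by (simp add: r_def cinner_diff_right)
    qed
    then have orth: "cinner e e' = 0" if "e \<in> E" for e
      using that by (simp add: e'_def cinner_scaleC_right)
    then have orth': "cinner e' e = 0" if "e \<in> E" for e
      using that cinner_commute[of e' e] by simp
    have norm_e': "cinner e' e' = 1"
      using False by (simp add: cinner_self e'_def norm_scaleC norm_divide)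
    have "e' \<notin> E" using orth norm_e' by force
    have zero: "cinner e' (\<Sum>e\<in>E. c e *\<^sub>C e) = 0" for c
      by (simp add: cinner_sum_right cinner_scaleC_right orth')
    have r: "r = complex_of_real (norm r) *\<^sub>C e'"
      using False by (simp add: e'_def scaleC_scaleC flip: of_real_mult)
    have b: "b = (\<Sum>e\<in>E. cinner e b *\<^sub>C e) + r" by (simp add: r_def)
    then have "cinner e' b = cinner e' r" using zero by (metis cinner_add_right add_0)
    also have "\<dots> = complex_of_real (norm r)"
      by (subst r) (simp add: cinner_scaleC_right norm_e')
    finally have "b = (\<Sum>e\<in>insert e' E. cinner e b *\<^sub>C e)"
      using E(1) \<open>e' \<notin> E\<close> b r by (simp add: add.commute)
    moreover have "x = (\<Sum>e\<in>insert e' E. cinner e x *\<^sub>C e)" if "x \<in> B" for x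
    proof -
      have "cinner e' x = 0" using zero B[OF that] by metis
      then show ?thesis using E(1) \<open>e' \<notin> E\<close> B[OF that] by simp
    qed
    ultimately show ?thesis
      using E \<open>e' \<notin> E\<close> orth orth' norm_e'
      by (intro exI[of _ "insert e' E"]) auto
  qed
qed

lemma orthonormal_basis_exists:
  obtains E :: "'a::fd_complex_hilbert set"
  where "finite E" "\<And>e. e \<in> E \<Longrightarrow> norm e = 1" "\<And>x. x = (\<Sum>e\<in>E. cinner e x *\<^sub>C e)"
proof -
  obtain B :: "'a set" where "finite B" and B: "\<And>x. \<exists>c. x = (\<Sum>b\<in>B. c b *\<^sub>C b)"
    using finite_dimensional by blast
  then obtain E where E: "finite E" "\<And>e f. e \<in> E \<Longrightarrow> f \<in> E \<Longrightarrow> cinner e f = (if e = f then 1 else 0)"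
    and EB: "\<And>b. b \<in> B \<Longrightarrow> b = (\<Sum>e\<in>E. cinner e b *\<^sub>C e)"
    using orthonormal_extension[of B] by metis
  have "norm e = 1" if "e \<in> E" for e
  proof -
    have "complex_of_real ((norm e)\<^sup>2) = 1"
      using cinner_self[of e] E(2)[OF that that] by simp
    then have "(norm e)\<^sup>2 = 1" by (simp only: of_real_eq_1_iff)
    then show ?thesis by (simp add: power2_eq_1_iff) (smt (verit) norm_ge_zero)
  qed
  moreover have "x = (\<Sum>e\<in>E. cinner e x *\<^sub>C e)" for x
  proof -
    obtain c where x: "x = (\<Sum>b\<in>B. c b *\<^sub>C b)" using B by blast
    have "x = (\<Sum>b\<in>B. c b *\<^sub>C (\<Sum>e\<in>E. cinner e b *\<^sub>C e))"
      using x EB by (metis (mono_tags, lifting) sum.cong)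
    also have "\<dots> = (\<Sum>e\<in>E. \<Sum>b\<in>B. c b *\<^sub>C cinner e b *\<^sub>C e)"
      unfolding scaleC.scale_sum_right by (rule sum.swap)
    also have "\<dots> = (\<Sum>e\<in>E. cinner e x *\<^sub>C e)"
      by (simp add: x cinner_sum_right cinner_scaleC_right scaleC.scale_sum_left scaleC_scaleC)
    finally show ?thesis .
  qed
  ultimately show ?thesis by (rule that[OF E(1)])
qed

lemma clinear_simps:
  assumes "clinear f"
  shows "f (x + y) = f x + f y" "f (x - y) = f x - f y" "f (c *\<^sub>C x) = c *\<^sub>C f x" "f 0 = 0"
    "f (\<Sum>i\<in>I. h i) = (\<Sum>i\<in>I. f (h i))" "f (- x) = - f x"
proof -
  interpret Vector_Spaces.linear scaleC scaleC f by fact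
  show "f (x + y) = f x + f y" "f (x - y) = f x - f y" "f (c *\<^sub>C x) = c *\<^sub>C f x" "f 0 = 0"
    "f (\<Sum>i\<in>I. h i) = (\<Sum>i\<in>I. f (h i))" "f (- x) = - f x"
    by (simp_all add: add diff scale sum neg)
qed

lemma clinearI:
  assumes "\<And>x y. f (x + y) = f x + f y" "\<And>c x. f (c *\<^sub>C x) = c *\<^sub>C f x"
  shows "clinear f"
  by (simp add: Vector_Spaces.linear_iff vector_space_scaleC assms)

lemma clinear_bounded:
  fixes f :: "'a::fd_complex_hilbert \<Rightarrow> 'b::fd_complex_hilbert"
  assumes "clinear f"
  shows "bounded_linear f"
proof -
  obtain E :: "'a set" where E: "finite E" "\<And>e. e \<in> E \<Longrightarrow> norm e = 1"
    "\<And>x. x = (\<Sum>e\<in>E. cinner e x *\<^sub>C e)"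
    using orthonormal_basis_exists by metis
  have "norm (f x) \<le> norm x * (\<Sum>e\<in>E. norm (f e))" for x
  proof -
    have "f x = (\<Sum>e\<in>E. cinner e x *\<^sub>C f e)"
      by (subst E(3)) (simp add: clinear_simps[OF assms])
    then have "norm (f x) \<le> (\<Sum>e\<in>E. norm (cinner e x *\<^sub>C f e))"
      by (simp add: norm_sum)
    also have "\<dots> \<le> (\<Sum>e\<in>E. norm x * norm (f e))"
    proof (rule sum_mono)
      fix e assume "e \<in> E"
      then have "norm (cinner e x) \<le> norm x" using E(2) norm_cinner_le[of e x] by simp
      then show "norm (cinner e x *\<^sub>C f e) \<le> norm x * norm (f e)"
        by (simp add: norm_scaleC mult_right_mono)
    qed
    finally show ?thesis by (simp add: sum_distrib_left)
  qed
  then show ?thesis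
    by (intro bounded_linear_intro[of f "\<Sum>e\<in>E. norm (f e)"])
      (simp_all add: clinear_simps[OF assms] scaleR_scaleC)
qed

text \<open>Completeness is not a class axiom. It is inherited from the complex numbers coordinate
  by coordinate and later yields the limits that define means.\<close>

lemma Cauchy_convergent_fd:
  fixes X :: "nat \<Rightarrow> 'a::fd_complex_hilbert"
  assumes "Cauchy X"
  shows "convergent X"
proof -
  obtain E :: "'a set" where E: "finite E" "\<And>x. x = (\<Sum>e\<in>E. cinner e x *\<^sub>C e)"
    using orthonormal_basis_exists by metis
  have "convergent (\<lambda>n. cinner e (X n))" for e
    by (intro Cauchy_convergent bounded_linear.Cauchy[OF bounded_linear_cinner_right assms])
  then have "convergent (\<lambda>n. cinner e (X n) *\<^sub>C e)" for e
    using bounded_linear.tendsto[OF bounded_linear_scaleC_left[of e]] unfolding convergent_def by blast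
  then have "convergent (\<lambda>n. \<Sum>e\<in>E. cinner e (X n) *\<^sub>C e)"
    by (intro convergent_sum)
  then show ?thesis using E(2) by simp
qed


section \<open>Joint spectral points as eigencharacters\<close>

lemma operator_algebra_clinear:
  assumes "\<And>A. A \<in> S \<Longrightarrow> clinear A" and "A \<in> operator_algebra S"
  shows "clinear A"
  using assms(2)
proof (induction rule: operator_algebra.induct)
  case (scale A c)
  then show ?case
    by (intro clinearI) (simp_all add: clinear_simps scaleC_add_right scaleC_scaleC mult.commute)
next
  case (mult A B)
  then show ?case by (intro clinearI) (simp_all add: clinear_simps)
qed (auto intro!: clinearI simp: assms(1) clinear_simps scaleC_add_right)

lemma operator_algebra_funpow: "A \<in> operator_algebra S \<Longrightarrow> A ^^ n \<in> operator_algebra S"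
  by (induction n) (auto intro: operator_algebra.unit operator_algebra.mult)

lemma operator_algebra_zero: "(\<lambda>x. 0) \<in> operator_algebra S"
  using operator_algebra.scale[OF operator_algebra.unit, of 0 S] by simp

lemma operator_algebra_sum:
  assumes "\<And>i. i \<in> I \<Longrightarrow> A i \<in> operator_algebra S"
  shows "(\<lambda>x. \<Sum>i\<in>I. A i x) \<in> operator_algebra S"
  using assms
  by (induction I rule: infinite_finite_induct)
    (simp_all add: operator_algebra_zero operator_algebra.add)

lemma clinear_funpow: "clinear A \<Longrightarrow> clinear (A ^^ n)" for A :: "'a::fd_complex_hilbert \<Rightarrow> 'a"
  by (induction n) (auto intro!: clinearI simp: clinear_simps)

lemma sum_fun_eq: "(\<Sum>i\<in>I. f i) = (\<lambda>x. \<Sum>i\<in>I. f i x)"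
  by (induction I rule: infinite_finite_induct) (simp_all add: zero_fun_def plus_fun_def)

text \<open>A modest substitute for Cayley-Hamilton: every linear operator lies in the span of the
  finitely many rank-one maps \<open>R p\<close>, so one power more than their number forces a
  relation. Neither a determinant nor the exact degree matters.\<close>

lemma funpow_linear_relation:
  fixes A :: "'a::fd_complex_hilbert \<Rightarrow> 'a"
  assumes "clinear A"
  shows "\<exists>c n k. k \<le> n \<and> c k \<noteq> 0 \<and> (\<forall>x. (\<Sum>j\<le>n. c j *\<^sub>C (A ^^ j) x) = 0)"
proof -
  interpret F: vector_space "\<lambda>c (f::'a \<Rightarrow> 'a) x. c *\<^sub>C f x"
    by unfold_locales (auto simp: fun_eq_iff scaleC_add_right scaleC_add_left scaleC_scaleC)
  obtain E :: "'a set" where E: "finite E" "\<And>x. x = (\<Sum>e\<in>E. cinner e x *\<^sub>C e)"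
    using orthonormal_basis_exists by metis
  define R :: "'a \<times> 'a \<Rightarrow> 'a \<Rightarrow> 'a" where "R = (\<lambda>(d, e) x. cinner d x *\<^sub>C e)"
  have in_span: "f \<in> F.span (R ` (E \<times> E))" if "clinear f" for f
  proof -
    have "f x = (\<Sum>p\<in>E \<times> E. cinner (snd p) (f (fst p)) *\<^sub>C R p x)" for x
    proof -
      have "f x = (\<Sum>d\<in>E. cinner d x *\<^sub>C f d)"
        by (subst E(2)) (simp add: clinear_simps[OF that])
      also have "\<dots> = (\<Sum>d\<in>E. cinner d x *\<^sub>C (\<Sum>e\<in>E. cinner e (f d) *\<^sub>C e))"
        using E(2) by simp
      also have "\<dots> = (\<Sum>d\<in>E. \<Sum>e\<in>E. cinner e (f d) *\<^sub>C R (d, e) x)"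
        by (simp add: scaleC.scale_sum_right scaleC_scaleC R_def mult.commute)
      finally show ?thesis by (simp add: sum.cartesian_product case_prod_unfold)
    qed
    then have "f = (\<Sum>p\<in>E \<times> E. (\<lambda>x. cinner (snd p) (f (fst p)) *\<^sub>C R p x))"
      unfolding sum_fun_eq by (rule ext)
    also have "\<dots> \<in> F.span (R ` (E \<times> E))"
      by (intro F.span_sum F.span_scale F.span_base imageI)
    finally show ?thesis .
  qed
  define n where "n = card (R ` (E \<times> E))"
  define P where "P = (\<lambda>j. A ^^ j)"
  \<comment> \<open>Dependence is a property of sets, so coinciding powers are invisible to it. If
    two powers agree, their difference is the required relation.\<close>
  show ?thesis
  proof (cases "inj_on P {..n}")
    case True
    have "F.dependent (P ` {..n})"
    proof (rule ccontr)
      assume "F.independent (P ` {..n})"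
      then have "card (P ` {..n}) \<le> n"
        unfolding n_def using E(1) in_span clinear_funpow[OF assms]
        by (intro conjunct2[OF F.independent_span_bound]) (auto simp: P_def)
      then show False using True by (simp add: card_image)
    qed
    then obtain u k where "k \<le> n" "u (P k) \<noteq> 0" "(\<Sum>v\<in>P ` {..n}. (\<lambda>x. u v *\<^sub>C v x)) = 0"
      by (auto simp: F.dependent_finite)
    moreover from this(3) have "(\<Sum>j\<le>n. u (P j) *\<^sub>C (A ^^ j) x) = 0" for x
      using True by (simp add: sum.reindex sum_fun_eq zero_fun_def fun_eq_iff P_def)
    ultimately show ?thesis by (intro exI[of _ "\<lambda>j. u (P j)"] exI[of _ n] exI[of _ k]) simp
  next
    case False
    then obtain i j where ij: "i \<le> n" "j \<le> n" "i \<noteq> j" "A ^^ i = A ^^ j"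
      by (auto simp: inj_on_def P_def)
    define c :: "nat \<Rightarrow> complex" where "c = (\<lambda>l. if l = i then 1 else if l = j then -1 else 0)"
    have "(\<Sum>l\<le>n. c l *\<^sub>C (A ^^ l) x) = 0" for x
    proof -
      have "(\<Sum>l\<le>n. c l *\<^sub>C (A ^^ l) x) = (\<Sum>l\<in>{i, j}. c l *\<^sub>C (A ^^ l) x)"
        using ij by (intro sum.mono_neutral_right) (auto simp: c_def)
      also have "\<dots> = 0" using ij by (simp add: c_def)
      finally show ?thesis .
    qed
    moreover have "c i \<noteq> 0" by (simp add: c_def)
    ultimately show ?thesis using ij(1) by blast
  qed
qed

text \<open>Cancelling the lowest power in a linear relation between the powers of \<open>A\<close> expresses the
  inverse of \<open>A\<close> as a polynomial in \<open>A\<close>.\<close>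

lemma inv_in_operator_algebra:
  fixes A :: "'a::fd_complex_hilbert \<Rightarrow> 'a"
  assumes lin: "clinear A" and inj: "inj A" and A: "A \<in> operator_algebra S"
  shows "inv A \<in> operator_algebra S"
proof -
  from funpow_linear_relation[OF lin]
  obtain c :: "nat \<Rightarrow> complex" and n k
    where *: "k \<le> n \<and> c k \<noteq> 0 \<and> (\<forall>x. (\<Sum>j\<le>n. c j *\<^sub>C (A ^^ j) x) = 0)"
    by (elim exE)
  then have "k \<le> n" "c k \<noteq> 0" and rel: "(\<Sum>j\<le>n. c j *\<^sub>C (A ^^ j) x) = 0" for x
    by simp_all
  define m where "m = (LEAST k. c k \<noteq> 0)"
  have below: "c j = 0" if "j < m" for j
    using that not_less_Least unfolding m_def by blast
  have m: "c m \<noteq> 0" "m \<le> n"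
    using LeastI[of "\<lambda>k. c k \<noteq> 0", OF \<open>c k \<noteq> 0\<close>] Least_le[of "\<lambda>k. c k \<noteq> 0", OF \<open>c k \<noteq> 0\<close>] \<open>k \<le> n\<close>
    by (simp_all add: m_def)
  define B where "B = (\<lambda>x. \<Sum>j\<in>{m<..n}. (- c j / c m) *\<^sub>C (A ^^ (j - m - 1)) x)"
  have "A (B x) = x" for x
  proof -
    have "0 = (\<Sum>j\<in>{m..n}. c j *\<^sub>C (A ^^ j) x)"
      using rel[of x] below
      by (subst sum.mono_neutral_left[of "{..n}" "{m..n}"]) auto
    also have "\<dots> = (\<Sum>j\<in>{m..n}. (A ^^ m) (c j *\<^sub>C (A ^^ (j - m)) x))"
    proof (rule sum.cong)
      fix j assume "j \<in> {m..n}"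
      then have "A ^^ j = A ^^ m \<circ> A ^^ (j - m)" by (metis atLeastAtMost_iff funpow_add le_add_diff_inverse)
      then show "c j *\<^sub>C (A ^^ j) x = (A ^^ m) (c j *\<^sub>C (A ^^ (j - m)) x)"
        by (simp add: clinear_simps[OF clinear_funpow[OF lin]])
    qed simp
    also have "\<dots> = (A ^^ m) (\<Sum>j\<in>{m..n}. c j *\<^sub>C (A ^^ (j - m)) x)"
      by (simp add: clinear_simps[OF clinear_funpow[OF lin]])
    finally have "(A ^^ m) (\<Sum>j\<in>{m..n}. c j *\<^sub>C (A ^^ (j - m)) x) = (A ^^ m) 0"
      by (simp add: clinear_simps[OF clinear_funpow[OF lin]])
    moreover have "inj (A ^^ m)" using inj by (induction m) (auto intro: inj_compose)
    ultimately have "0 = (\<Sum>j\<in>{m..n}. c j *\<^sub>C (A ^^ (j - m)) x)" by (metis injD)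
    also have "{m..n} = insert m {m<..n}" using m by auto
    finally have "0 = c m *\<^sub>C x + (\<Sum>j\<in>{m<..n}. c j *\<^sub>C (A ^^ (j - m)) x)" by simp
    then have "c m *\<^sub>C x = - (\<Sum>j\<in>{m<..n}. c j *\<^sub>C (A ^^ (j - m)) x)"
      by (metis add_eq_0_iff2)
    also have "\<dots> = (\<Sum>j\<in>{m<..n}. (- c j) *\<^sub>C (A ^^ (j - m)) x)"
      by (simp add: sum_negf)
    also have "\<dots> = (\<Sum>j\<in>{m<..n}. c m *\<^sub>C A ((- c j / c m) *\<^sub>C (A ^^ (j - m - 1)) x))"
    proof (rule sum.cong)
      fix j assume "j \<in> {m<..n}"
      then have "A ^^ (j - m) = A \<circ> A ^^ (j - m - 1)"
        by (metis Suc_diff_1 funpow.simps(2) greaterThanAtMost_iff zero_less_diff)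
      then show "(- c j) *\<^sub>C (A ^^ (j - m)) x = c m *\<^sub>C A ((- c j / c m) *\<^sub>C (A ^^ (j - m - 1)) x)"
        using m by (simp add: clinear_simps[OF lin] scaleC_scaleC)
    qed simp
    also have "\<dots> = c m *\<^sub>C A (B x)"
      by (simp add: B_def clinear_simps[OF lin] scaleC.scale_sum_right)
    finally show ?thesis using m by simp
  qed
  then have "inv A = B" using inj by (metis inv_f_f ext)
  moreover have "B \<in> operator_algebra S"
    unfolding B_def
    by (intro operator_algebra_sum operator_algebra.scale operator_algebra_funpow A)
  ultimately show ?thesis by simp
qed

lemma banach_algebra_gen_superset:
  assumes "\<And>A. A \<in> S \<Longrightarrow> clinear A"
  shows "operator_algebra S \<subseteq> banach_algebra_gen S"
proof
  fix A assume A: "A \<in> operator_algebra S"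
  then show "A \<in> banach_algebra_gen S"
    unfolding banach_algebra_gen_def using operator_algebra_clinear[OF assms A]
    by (auto intro!: exI[of _ "\<lambda>_. A"] simp: onorm_zero)
qed

section \<open>The unitary representation by linear parts\<close>

locale isometric_action =
  fixes \<tau> :: "'g::ab_group_add \<Rightarrow> 'x::fd_complex_hilbert \<Rightarrow> 'x"
  assumes affine: "\<tau> \<gamma> \<in> affine_isometries"
    and hom: "\<tau> (\<gamma> + \<delta>) = \<tau> \<gamma> \<circ> \<tau> \<delta>"
begin

abbreviation T :: "'g \<Rightarrow> 'x \<Rightarrow> 'x" where "T \<gamma> \<equiv> linear_part (\<tau> \<gamma>)"

lemma linear_part_obtain:
  obtains b where "clinear (T \<gamma>)" "\<And>x. norm (T \<gamma> x) = norm x" "\<And>x. \<tau> \<gamma> x = T \<gamma> x + b"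
proof -
  obtain U b where U: "clinear U" "\<And>x. norm (U x) = norm x" "\<tau> \<gamma> = (\<lambda>x. U x + b)"
    using affine[of \<gamma>] unfolding affine_isometries_def by blast
  then show ?thesis using linear_part_affine[OF U(1), of b] that[of b] by simp
qed

lemma clinear_T: "clinear (T \<gamma>)" and norm_T [simp]: "norm (T \<gamma> x) = norm x"
  by (metis linear_part_obtain)+

lemmas T_simps = clinear_simps[OF clinear_T]

lemma T_add: "T (\<gamma> + \<delta>) x = T \<gamma> (T \<delta> x)"
proof -
  obtain b c where "\<And>x. \<tau> \<gamma> x = T \<gamma> x + b" "\<And>x. \<tau> \<delta> x = T \<delta> x + c"
    by (metis linear_part_obtain)
  then have "\<tau> \<gamma> (\<tau> \<delta> x) - \<tau> \<gamma> (\<tau> \<delta> 0) = T \<gamma> (T \<delta> x)" by (simp add: T_simps)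
  then show ?thesis by (simp add: linear_part_def hom)
qed

lemma inj_T: "inj (T \<gamma>)"
proof (rule injI)
  fix x y assume "T \<gamma> x = T \<gamma> y"
  then have "norm (T \<gamma> (x - y)) = 0" by (simp add: T_simps)
  then show "x = y" by simp
qed

lemma T_zero [simp]: "T 0 x = x"
  using T_add[of 0 0 x] inj_T by (metis add_0 injD)

lemma T_minus_cancel [simp]: "T (- \<gamma>) (T \<gamma> x) = x" "T \<gamma> (T (- \<gamma>) x) = x"
  by (simp_all flip: T_add)

lemma inv_T: "inv (T \<gamma>) = T (- \<gamma>)"
  by (rule inv_equality) simp_all

text \<open>The induction follows the generation of \<open>range T\<close> as a group and carries
  membership in the algebra along, since \<open>\<psi>\<close> is multiplicative only there. For
  inverses, \<open>inv_in_operator_algebra\<close> supplies membership, and then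
  \<open>\<psi> (inv A) * \<psi> A = 1\<close> determines the eigenvalue.\<close>

lemma eigenvector_mult_functional:
  assumes gen: "operator_group (T ` S) = range T"
    and \<psi>: "mult_functional (banach_algebra_gen (T ` S)) \<psi>"
    and a: "a \<noteq> 0" "\<And>\<gamma>. \<gamma> \<in> S \<Longrightarrow> T \<gamma> a = \<psi> (T \<gamma>) *\<^sub>C a"
  shows "T \<gamma> a = \<psi> (T \<gamma>) *\<^sub>C a"
proof -
  let ?B = "banach_algebra_gen (T ` S)"
  have sub: "operator_algebra (T ` S) \<subseteq> ?B"
    by (rule banach_algebra_gen_superset) (auto simp: clinear_T)
  have \<psi>_mult: "\<psi> (A \<circ> B) = \<psi> A * \<psi> B" if "A \<in> ?B" "B \<in> ?B" for A B
    using \<psi> that unfolding mult_functional_def by blast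
  obtain A where A: "A \<in> ?B" "\<psi> A \<noteq> 0" using \<psi> unfolding mult_functional_def by blast
  have id: "id \<in> ?B" using sub operator_algebra.unit by blast
  \<comment> \<open>Some \<open>A\<close> has \<open>\<psi> A\<close> non-zero, and
    \<open>A = A \<circ> id\<close>; cancelling \<open>\<psi> A\<close> leaves the value at the
    identity.\<close>
  then have psi_id: "\<psi> id = 1" using \<psi>_mult[OF A(1) id] A(2) by simp
  have "A \<in> operator_algebra (T ` S) \<and> A a = \<psi> A *\<^sub>C a" if "A \<in> operator_group (T ` S)" for A
    using that
  proof (induction rule: operator_group.induct)
    case unit
    show ?case
      using operator_algebra.unit psi_id by (metis id_apply scaleC.scale_one)
  next
    case (gen A)
    then show ?case using a by (auto intro: operator_algebra.gen)
  next
    case (mult A B)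
    then obtain \<gamma> where "A = T \<gamma>" using gen by blast
    then have "A (B a) = (\<psi> A * \<psi> B) *\<^sub>C a"
      using mult by (simp add: T_simps scaleC_scaleC mult.commute)
    moreover have "\<psi> (A \<circ> B) = \<psi> A * \<psi> B" using mult sub \<psi>_mult by blast
    ultimately have "(A \<circ> B) a = \<psi> (A \<circ> B) *\<^sub>C a" by (metis comp_apply)
    then show ?case using mult by (blast intro: operator_algebra.mult)
  next
    case (inverse A)
    then obtain \<gamma> where \<gamma>: "A = T \<gamma>" using gen by blast
    have inv: "inv A \<in> operator_algebra (T ` S)"
      using inverse by (intro inv_in_operator_algebra) (auto simp: \<gamma> clinear_T inj_T)
    have "inv A \<circ> A = id" by (simp add: \<gamma> inj_T)
    then have "\<psi> (inv A) * \<psi> A = 1" using \<psi>_mult[of "inv A" A] inv inverse sub psi_id by auto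
    moreover have "T (- \<gamma>) (T \<gamma> a) = \<psi> A *\<^sub>C T (- \<gamma>) a"
      using inverse by (simp only: \<gamma> T_simps)
    then have "a = \<psi> A *\<^sub>C inv A a" by (simp add: \<gamma> inv_T)
    ultimately have "inv A a = \<psi> (inv A) *\<^sub>C a"
      by (metis scaleC.scale_one scaleC_scaleC)
    then show ?case using inv by simp
  qed
  then show ?thesis using gen by blast
qed

lemma eigenvalue_unitary:
  assumes "a \<noteq> 0" "T \<gamma> a = c *\<^sub>C a"
  shows "norm c = 1"
  using norm_T[of \<gamma> a] assms by (simp add: norm_scaleC)

text \<open>Eigenvalues inherit multiplicativity from \<open>T\<close> because \<open>a\<close> is
  non-zero, and they are unimodular because \<open>T\<close> is isometric. Conjugation is therefore
  inversion, which explains why joint spectral points are conjugates of eigenvalue characters: the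
  conjugate twists \<open>T\<close> so that \<open>a\<close> becomes fixed.\<close>

lemma eigencharacter:
  assumes a: "a \<noteq> 0" "\<And>\<gamma>. T \<gamma> a = \<xi> \<gamma> *\<^sub>C a"
  shows "(\<lambda>\<gamma>. cnj (\<xi> \<gamma>)) \<in> dual_group" "cnj (\<xi> \<gamma>) *\<^sub>C T \<gamma> a = a"
proof -
  have n: "norm (\<xi> \<gamma>) = 1" for \<gamma> using eigenvalue_unitary a by blast
  have "\<xi> (\<gamma> + \<delta>) *\<^sub>C a = (\<xi> \<gamma> * \<xi> \<delta>) *\<^sub>C a" for \<gamma> \<delta>
    using T_add[of \<gamma> \<delta> a] by (simp add: a T_simps scaleC_scaleC mult.commute)
  then have "\<xi> (\<gamma> + \<delta>) = \<xi> \<gamma> * \<xi> \<delta>" for \<gamma> \<delta> using a by simp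
  then show "(\<lambda>\<gamma>. cnj (\<xi> \<gamma>)) \<in> dual_group" using n by (simp add: dual_group_def)
  have "cnj (\<xi> \<gamma>) * \<xi> \<gamma> = 1"
    using complex_norm_square[of "\<xi> \<gamma>"] n by (simp add: mult.commute)
  then show "cnj (\<xi> \<gamma>) *\<^sub>C T \<gamma> a = a" by (simp add: a scaleC_scaleC)
qed

text \<open>\<open>joint_spectral_points\<close> is a union over generating lists, so membership in
  it requires a concrete one; generators of the group provide it.\<close>

lemma operator_group_generators:
  assumes "group_closure S = UNIV"
  shows "operator_group (T ` S) = range T"
proof
  show "operator_group (T ` S) \<subseteq> range T"
  proof
    fix A assume "A \<in> operator_group (T ` S)"
    then show "A \<in> range T"
    proof (induction rule: operator_group.induct)
      case unit
      then show ?case by (intro range_eqI[of _ _ 0]) (simp add: fun_eq_iff)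
    next
      case (mult A B)
      then obtain \<gamma> \<delta> where "A = T \<gamma>" "B = T \<delta>" by blast
      then show ?case by (intro range_eqI[of _ _ "\<gamma> + \<delta>"]) (simp add: fun_eq_iff T_add)
    next
      case (inverse A)
      then show ?case by (auto simp: inv_T)
    qed auto
  qed
  have "T \<gamma> \<in> operator_group (T ` S)" if "\<gamma> \<in> group_closure S" for \<gamma>
    using that
  proof (induction rule: group_closure.induct)
    \<comment> \<open>The base rule of \<open>group_closure\<close> also admits the neutral element,
      hence the separate treatment of \<open>T 0\<close>.\<close>
    case (base s)
    have "T 0 \<in> operator_group (T ` S)"
      using operator_group.unit by (metis T_zero eq_id_iff)
    then show ?case using base by (auto intro: operator_group.gen)
  next
    case (diff s t)
    have "T (s - t) = T s \<circ> inv (T t)" using T_add[of s "- t"] by (simp add: inv_T fun_eq_iff)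
    moreover have "T s \<circ> inv (T t) \<in> operator_group (T ` S)"
      using diff by (intro operator_group.mult operator_group.inverse)
    ultimately show ?case by metis
  qed
  then show "range T \<subseteq> operator_group (T ` S)" using assms by auto
qed

text \<open>The functional is the eigenvalue at \<open>a\<close>, written as a Rayleigh quotient to
  make it total and visibly linear in the operator. Only multiplicativity needs \<open>a\<close> to
  be an eigenvector throughout the closed algebra; this property holds on the generators, survives
  the algebra operations and passes to norm limits.\<close>

lemma mult_functional_eigenvector:
  assumes S: "\<And>A. A \<in> S \<Longrightarrow> clinear A" and a: "a \<noteq> 0" "\<And>A. A \<in> S \<Longrightarrow> A a = l A *\<^sub>C a"
  shows "mult_functional (banach_algebra_gen S) (\<lambda>A. cinner a (A a) / cinner a a)"
proof -
  define \<psi> where "\<psi> = (\<lambda>A. cinner a (A a) / cinner a a)"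
  have aa: "cinner a a \<noteq> 0" using a by (simp add: cinner_self)
  have \<psi>I: "A a = \<psi> A *\<^sub>C a" if "A a = c *\<^sub>C a" for A c
    using that aa by (simp add: \<psi>_def cinner_scaleC_right)
  have alg: "A a = \<psi> A *\<^sub>C a" if "A \<in> operator_algebra S" for A
    using that
  proof (induction rule: operator_algebra.induct)
    case unit
    show ?case by (rule \<psi>I[of _ 1]) simp
  next
    case (gen A)
    then show ?case using a by (metis \<psi>I)
  next
    case (add A B)
    then show ?case by (intro \<psi>I[of _ "\<psi> A + \<psi> B"]) (metis scaleC_add_left)
  next
    case (scale A c)
    then show ?case by (intro \<psi>I[of _ "c * \<psi> A"]) (metis scaleC_scaleC)
  next
    case (mult A B)
    have "clinear A" using operator_algebra_clinear S mult by blast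
    then have "(A \<circ> B) a = \<psi> B *\<^sub>C A a" using mult by (metis comp_apply clinear_simps(3))
    then show ?case using mult by (intro \<psi>I[of _ "\<psi> B * \<psi> A"]) (metis scaleC_scaleC)
  qed
  have eig: "A a = \<psi> A *\<^sub>C a" if A: "A \<in> banach_algebra_gen S" for A
  proof -
    obtain F where F: "\<And>n. F n \<in> operator_algebra S" "clinear A"
      and lim: "(\<lambda>n. onorm (\<lambda>x. F n x - A x)) \<longlonglongrightarrow> 0"
      using A unfolding banach_algebra_gen_def by blast
    have "bounded_linear (\<lambda>x. F n x - A x)" for n
      using F operator_algebra_clinear[OF S F(1)] by (intro bounded_linear_sub clinear_bounded)
    then have "\<forall>\<^sub>F n in sequentially. norm (F n a - A a) \<le> onorm (\<lambda>x. F n x - A x) * norm a"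
      using onorm by (intro always_eventually allI) fast
    moreover have "(\<lambda>n. onorm (\<lambda>x. F n x - A x) * norm a) \<longlonglongrightarrow> 0"
      using tendsto_mult_right[OF lim, of "norm a"] by simp
    ultimately have "(\<lambda>n. F n a - A a) \<longlonglongrightarrow> 0"
      by (rule Lim_null_comparison)
    then have 1: "(\<lambda>n. F n a) \<longlonglongrightarrow> A a" by (simp add: LIM_zero_iff)
    then have "(\<lambda>n. \<psi> (F n)) \<longlonglongrightarrow> \<psi> A"
      unfolding \<psi>_def using aa
      by (intro tendsto_divide bounded_linear.tendsto[OF bounded_linear_cinner_right] tendsto_const)
    then have "(\<lambda>n. \<psi> (F n) *\<^sub>C a) \<longlonglongrightarrow> \<psi> A *\<^sub>C a"
      by (rule bounded_linear.tendsto[OF bounded_linear_scaleC_left])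
    then have "(\<lambda>n. F n a) \<longlonglongrightarrow> \<psi> A *\<^sub>C a" using alg[OF F(1)] by simp
    with 1 show ?thesis by (rule LIMSEQ_unique)
  qed
  have id: "id \<in> banach_algebra_gen S"
    using banach_algebra_gen_superset[OF S] operator_algebra.unit by blast
  have "\<psi> (A \<circ> B) = \<psi> A * \<psi> B" if "A \<in> banach_algebra_gen S" "B \<in> banach_algebra_gen S" for A B
  proof -
    have "clinear A" using that by (simp add: banach_algebra_gen_def)
    then have "A (B a) = \<psi> B *\<^sub>C \<psi> A *\<^sub>C a" using eig that by (metis clinear_simps(3))
    then show ?thesis using aa by (simp add: \<psi>_def cinner_scaleC_right)
  qed
  moreover have "\<psi> id = 1" using aa by (simp add: \<psi>_def)
  ultimately show ?thesis
    unfolding mult_functional_def \<psi>_def[symmetric]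
  proof (intro conjI ballI allI)
    show "\<exists>A\<in>banach_algebra_gen S. \<psi> A \<noteq> 0"
      using id \<open>\<psi> id = 1\<close> by (metis zero_neq_one)
  qed (simp_all add: \<psi>_def cinner_add_right cinner_scaleC_right add_divide_distrib)
qed

text \<open>Removes tuples, closed algebras and functionals from the rest of the argument: from here
  on a joint spectral point is a character whose twist of \<open>T\<close> has a non-zero fixed
  vector.\<close>

lemma joint_spectral_points_eq:
  fixes S :: "'g set"
  assumes S: "finite S" "group_closure S = UNIV"
  shows "joint_spectral_points \<tau> = {\<xi> \<in> dual_group. \<exists>b. b \<noteq> 0 \<and> (\<forall>\<gamma>. \<xi> \<gamma> *\<^sub>C T \<gamma> b = b)}"
proof (intro equalityI subsetI)
  fix \<xi> assume "\<xi> \<in> joint_spectral_points \<tau>"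
  then obtain \<gamma>s where gen: "operator_group (set (map T \<gamma>s)) = range T"
    and "\<xi> \<in> joint_spectral_points_of \<tau> \<gamma>s"
    unfolding joint_spectral_points_def by blast
  then obtain \<psi> ls where js: "ls \<in> joint_spectrum (map T \<gamma>s)" "ls = map \<psi> (map T \<gamma>s)"
    and \<psi>: "mult_functional (banach_algebra_gen (set (map T \<gamma>s))) \<psi>"
    and \<xi>: "\<xi> = (\<lambda>\<gamma>. cnj (\<psi> (T \<gamma>)))"
    unfolding joint_spectral_points_of_def Let_def by blast
  from js obtain a where a: "a \<noteq> 0" "\<forall>j<length \<gamma>s. T (\<gamma>s ! j) a = \<psi> (T (\<gamma>s ! j)) *\<^sub>C a"
    unfolding joint_spectrum_def by auto
  then have "T \<gamma> a = \<psi> (T \<gamma>) *\<^sub>C a" if "\<gamma> \<in> set \<gamma>s" for \<gamma>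
    using that by (metis in_set_conv_nth)
  note eigenvector_mult_functional[OF gen[unfolded set_map] \<psi>[unfolded set_map] a(1) this]
  note * = eigencharacter[OF a(1) this]
  show "\<xi> \<in> {\<xi> \<in> dual_group. \<exists>b. b \<noteq> 0 \<and> (\<forall>\<gamma>. \<xi> \<gamma> *\<^sub>C T \<gamma> b = b)}"
    unfolding \<xi> by (intro CollectI conjI exI[of _ a] allI * a(1))
next
  fix \<xi> assume "\<xi> \<in> {\<xi> \<in> dual_group. \<exists>b. b \<noteq> 0 \<and> (\<forall>\<gamma>. \<xi> \<gamma> *\<^sub>C T \<gamma> b = b)}"
  then obtain b where \<xi>: "\<xi> \<in> dual_group" and b: "b \<noteq> 0" and *: "\<forall>\<gamma>. \<xi> \<gamma> *\<^sub>C T \<gamma> b = b"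
    by (elim CollectE conjE exE) (rule that)
  have eig: "T \<gamma> b = cnj (\<xi> \<gamma>) *\<^sub>C b" for \<gamma>
  proof -
    have "cnj (\<xi> \<gamma>) * \<xi> \<gamma> = 1"
      using complex_norm_square[of "\<xi> \<gamma>"] \<xi> by (simp add: mult.commute dual_group_def)
    then show ?thesis using arg_cong[OF spec[OF *, of \<gamma>], of "scaleC (cnj (\<xi> \<gamma>))"]
      by (simp add: scaleC_scaleC)
  qed
  define \<psi> where "\<psi> = (\<lambda>A. cinner b (A b) / cinner b b)"
  have bb: "cinner b b \<noteq> 0" using b by (simp add: cinner_self)
  have \<psi>_T: "\<psi> (T \<gamma>) = cnj (\<xi> \<gamma>)" for \<gamma>
    using bb by (simp add: \<psi>_def eig cinner_scaleC_right)
  obtain \<gamma>s where \<gamma>s: "set \<gamma>s = S" using finite_list S(1) by blast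
  have eig_S: "A b = \<psi> A *\<^sub>C b" if "A \<in> T ` S" for A
    using that by (auto simp: \<psi>_T intro: eig)
  have "mult_functional (banach_algebra_gen (T ` S)) \<psi>"
    unfolding \<psi>_def
    by (rule mult_functional_eigenvector[of _ _ \<psi>]) (auto simp: clinear_T b eig_S)
  then have "mult_functional (banach_algebra_gen (set (map T \<gamma>s))) \<psi>"
    by (simp only: set_map \<gamma>s)
  moreover have "map \<psi> (map T \<gamma>s) \<in> joint_spectrum (map T \<gamma>s)"
    using b by (auto simp: joint_spectrum_def \<psi>_T intro!: exI[of _ b] eig)
  moreover have "\<xi> = (\<lambda>\<gamma>. cnj (\<psi> (T \<gamma>)))" by (simp add: \<psi>_T)
  ultimately have "\<xi> \<in> joint_spectral_points_of \<tau> \<gamma>s"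
    unfolding joint_spectral_points_of_def Let_def by blast
  moreover have "operator_group (set (map T \<gamma>s)) = range T"
    unfolding set_map \<gamma>s by (rule operator_group_generators[OF S(2)])
  ultimately show "\<xi> \<in> joint_spectral_points \<tau>"
    unfolding joint_spectral_points_def by blast
qed

end


section \<open>Means and Fourier coefficients of almost periodic functions\<close>

lemma dual_groupD:
  assumes "\<xi> \<in> dual_group"
  shows "norm (\<xi> \<gamma>) = 1" "\<xi> (\<gamma> + \<delta>) = \<xi> \<gamma> * \<xi> \<delta>" "\<xi> 0 = 1" "cnj (\<xi> \<gamma>) * \<xi> \<gamma> = 1"
proof -
  show n: "norm (\<xi> \<gamma>) = 1" and add: "\<xi> (\<gamma> + \<delta>) = \<xi> \<gamma> * \<xi> \<delta>" for \<gamma> \<delta>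
    using assms by (simp_all add: dual_group_def)
  show "cnj (\<xi> \<gamma>) * \<xi> \<gamma> = 1"
    using complex_norm_square[of "\<xi> \<gamma>"] n by (simp add: mult.commute)
  show "\<xi> 0 = 1" using add[of 0 0] n[of 0] by auto
qed

lemma dual_group_cnj: "\<xi> \<in> dual_group \<Longrightarrow> (\<lambda>\<gamma>. cnj (\<xi> \<gamma>)) \<in> dual_group"
  by (simp add: dual_group_def)

lemma dual_group_mult: "\<xi> \<in> dual_group \<Longrightarrow> \<eta> \<in> dual_group \<Longrightarrow> (\<lambda>\<gamma>. \<xi> \<gamma> * \<eta> \<gamma>) \<in> dual_group"
  by (simp add: dual_group_def norm_mult)

lemma dual_group_generators:
  assumes \<xi>: "\<xi> \<in> dual_group" and S: "group_closure S = UNIV" "\<And>s. s \<in> S \<Longrightarrow> \<xi> s = 1"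
  shows "\<xi> = (\<lambda>_. 1)"
proof
  fix \<gamma>
  have "\<gamma> \<in> group_closure S" using S by simp
  then show "\<xi> \<gamma> = 1"
  proof (induction rule: group_closure.induct)
    case (base s)
    then show ?case using S(2) dual_groupD(3)[OF \<xi>] by auto
  next
    case (diff s t)
    then show ?case using dual_groupD(2)[OF \<xi>, of "s - t" t] by simp
  qed
qed

text \<open>The mean over all \<open>\<gamma> + j1 s1 + ... + jk sk\<close> with each coefficient
  between 0 and \<open>N\<close>, counted with multiplicity. There are \<open>Suc N\<close> values
  per generator, so the denominator never vanishes. Averaging one generator at a time makes the
  average of a character a product.\<close>

fun box_average :: "nat \<Rightarrow> 'g::ab_group_add list \<Rightarrow> ('g \<Rightarrow> 'z::real_vector) \<Rightarrow> 'g \<Rightarrow> 'z"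
  where
    "box_average N [] g \<gamma> = g \<gamma>"
  | "box_average N (s # ss) g \<gamma> =
      (1 / real (Suc N)) *\<^sub>R (\<Sum>j\<le>N. box_average N ss g ((plus s ^^ j) \<gamma>))"

lemma box_average_linear:
  assumes "linear f"
  shows "box_average N ss (\<lambda>\<gamma>. f (g \<gamma>)) \<gamma> = f (box_average N ss g \<gamma>)"
  by (induction ss arbitrary: \<gamma>) (simp_all add: linear_sum[OF assms] linear_cmul[OF assms])

lemma box_average_add:
  "box_average N ss (\<lambda>\<gamma>. g \<gamma> + h \<gamma>) \<gamma> = box_average N ss g \<gamma> + box_average N ss h \<gamma>"
  by (induction ss arbitrary: \<gamma>) (simp_all add: sum.distrib scaleR_add_right)

lemma box_average_diff:
  "box_average N ss (\<lambda>\<gamma>. g \<gamma> - h \<gamma>) \<gamma> = box_average N ss g \<gamma> - box_average N ss h \<gamma>"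
  by (induction ss arbitrary: \<gamma>) (simp_all add: sum_subtractf scaleR_diff_right)

lemma box_average_const: "box_average N ss (\<lambda>_. c) \<gamma> = c"
  by (induction ss arbitrary: \<gamma>) (simp_all add: sum_constant_scaleR)

lemma box_average_sum:
  "box_average N ss (\<lambda>\<gamma>. \<Sum>i\<in>I. g i \<gamma>) \<gamma> = (\<Sum>i\<in>I. box_average N ss (g i) \<gamma>)"
  by (induction I rule: infinite_finite_induct) (simp_all add: box_average_add box_average_const)

lemma box_average_mono:
  fixes u v :: "'g::ab_group_add \<Rightarrow> real"
  assumes "\<And>\<gamma>. u \<gamma> \<le> v \<gamma>"
  shows "box_average N ss u \<gamma> \<le> box_average N ss v \<gamma>"
  by (induction ss arbitrary: \<gamma>) (auto intro!: assms divide_right_mono sum_mono)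

lemma norm_box_average_le:
  fixes g :: "'g::ab_group_add \<Rightarrow> 'z::real_normed_vector"
  assumes "\<And>\<gamma>. norm (g \<gamma>) \<le> C"
  shows "norm (box_average N ss g \<gamma>) \<le> C"
proof (induction ss arbitrary: \<gamma>)
  case (Cons s ss)
  have "norm (\<Sum>j\<le>N. box_average N ss g ((plus s ^^ j) \<gamma>)) \<le> real (Suc N) * C"
    using sum_norm_bound[of "{..N}" "\<lambda>j. box_average N ss g ((plus s ^^ j) \<gamma>)" C] Cons by simp
  then show ?case by (simp add: field_simps)
qed (simp add: assms)

lemma box_average_character:
  assumes \<xi>: "\<xi> \<in> dual_group"
  shows "box_average N ss \<xi> \<gamma> = \<xi> \<gamma> * (\<Prod>s\<leftarrow>ss. (\<Sum>j\<le>N. \<xi> s ^ j) / of_nat (Suc N))"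
proof (induction ss arbitrary: \<gamma>)
  case (Cons s ss)
  have pow: "\<xi> ((plus s ^^ j) \<gamma>) = \<xi> s ^ j * \<xi> \<gamma>" for j
    by (induction j) (simp_all add: dual_groupD(2)[OF \<xi>])
  have "box_average N (s # ss) \<xi> \<gamma> = (1 / of_nat (Suc N)) *
      (\<Sum>j\<le>N. \<xi> s ^ j * (\<xi> \<gamma> * (\<Prod>s\<leftarrow>ss. (\<Sum>j\<le>N. \<xi> s ^ j) / of_nat (Suc N))))"
    by (simp only: box_average.simps Cons pow scaleR_conv_of_real) (simp add: mult_ac)
  then show ?case by (simp add: sum_distrib_right[symmetric] del: of_nat_Suc)
qed simp

lemma geometric_average_tendsto:
  assumes "norm (z::complex) = 1"
  shows "(\<lambda>N. (\<Sum>j\<le>N. z ^ j) / of_nat (Suc N)) \<longlonglongrightarrow> (if z = 1 then 1 else 0)"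
proof (cases "z = 1")
  case True
  then show ?thesis by (simp del: of_nat_Suc)
next
  case False
  \<comment> \<open>For \<open>z\<close> other than 1 the geometric sums are bounded uniformly in
    \<open>N\<close>: the numerator \<open>1 - z ^ Suc N\<close> has norm at most 2.\<close>
  have "\<forall>\<^sub>F N in sequentially. norm ((\<Sum>j\<le>N. z ^ j) / of_nat (Suc N))
      \<le> 2 / norm (1 - z) * inverse (real (Suc N))"
  proof (intro always_eventually allI)
    fix N
    have "norm (1 - z ^ Suc N) \<le> 2"
      using norm_triangle_ineq4[of 1 "z ^ Suc N"] assms by (simp add: norm_power norm_mult)
    then have "norm (\<Sum>j\<le>N. z ^ j) \<le> 2 / norm (1 - z)"
      using False by (simp add: sum_gp0 norm_divide divide_right_mono del: power_Suc)
    then show "norm ((\<Sum>j\<le>N. z ^ j) / of_nat (Suc N)) \<le> 2 / norm (1 - z) * inverse (real (Suc N))"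
      by (simp add: divide_inverse norm_mult norm_inverse mult_right_mono del: of_nat_Suc)
  qed
  moreover have "(\<lambda>N. 2 / norm (1 - z) * inverse (real (Suc N))) \<longlonglongrightarrow> 0"
    by (rule tendsto_mult_right_zero[OF LIMSEQ_inverse_real_of_nat])
  ultimately have "(\<lambda>N. (\<Sum>j\<le>N. z ^ j) / of_nat (Suc N)) \<longlonglongrightarrow> 0"
    by (rule Lim_null_comparison)
  then show ?thesis using False by simp
qed

text \<open>A non-trivial character differs from 1 on some generator. The geometric factor of that
  generator tends to 0, and all other factors converge, so the product vanishes in the
  limit.\<close>

lemma box_average_character_tendsto:
  assumes \<xi>: "\<xi> \<in> dual_group" and ss: "group_closure (set ss) = UNIV"
  shows "(\<lambda>N. box_average N ss \<xi> \<gamma>) \<longlonglongrightarrow> (if \<xi> = (\<lambda>_. 1) then 1 else 0)"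
proof (cases "\<xi> = (\<lambda>_. 1)")
  case True
  then show ?thesis by (simp add: box_average_const)
next
  case False
  then obtain s where s: "s \<in> set ss" "\<xi> s \<noteq> 1" using dual_group_generators[OF \<xi> ss] by blast
  have lim: "(\<lambda>N. \<Prod>s\<leftarrow>rs. (\<Sum>j\<le>N. \<xi> s ^ j) / of_nat (Suc N)) \<longlonglongrightarrow> (\<Prod>s\<leftarrow>rs. if \<xi> s = 1 then 1 else 0)" for rs
  proof (induction rs)
    case (Cons r rs)
    then show ?case
      using tendsto_mult[OF geometric_average_tendsto[OF dual_groupD(1)[OF \<xi>, of r]] Cons.IH]
      by (simp only: list.map prod_list.Cons)
  qed simp
  have "(\<Prod>s\<leftarrow>ss. if \<xi> s = 1 then 1 else 0 :: complex) = 0"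
    using s by (auto simp: prod_list_zero_iff)
  then have "(\<lambda>N. \<Prod>s\<leftarrow>ss. (\<Sum>j\<le>N. \<xi> s ^ j) / of_nat (Suc N)) \<longlonglongrightarrow> 0"
    using lim[of ss] by (simp only:)
  from tendsto_mult_right_zero[OF this, of "\<xi> \<gamma>"] show ?thesis
    using False by (simp only: box_average_character[OF \<xi>] if_False)
qed

section \<open>Trigonometric polynomials\<close>

inductive_set trig :: "('g::ab_group_add \<Rightarrow> 'z::fd_complex_hilbert) set"
  where
    zero: "(\<lambda>\<gamma>. 0) \<in> trig"
  | char_add: "\<xi> \<in> dual_group \<Longrightarrow> p \<in> trig \<Longrightarrow> (\<lambda>\<gamma>. \<xi> \<gamma> *\<^sub>C a + p \<gamma>) \<in> trig"

text \<open>Links the indexed sums of \<open>trig_polys\<close> to the inductive set, whose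
  induction principle adds one character term at a time.\<close>

lemma trig_sum:
  "(\<And>k. k < n \<Longrightarrow> \<xi> k \<in> dual_group) \<Longrightarrow> (\<lambda>\<gamma>. \<Sum>k<(n::nat). \<xi> k \<gamma> *\<^sub>C a k) \<in> trig"
proof (induction n)
  case (Suc n)
  then show ?case
    using trig.char_add[of "\<xi> n" "\<lambda>\<gamma>. \<Sum>k<n. \<xi> k \<gamma> *\<^sub>C a k" "a n"] by (simp add: add.commute)
qed (simp add: trig.zero)

lemma trig_add: "p \<in> trig \<Longrightarrow> q \<in> trig \<Longrightarrow> (\<lambda>\<gamma>. p \<gamma> + q \<gamma>) \<in> trig"
  by (induction rule: trig.induct) (auto simp: add.assoc intro: trig.char_add)

lemma trig_clinear:
  assumes "clinear f" "p \<in> trig"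
  shows "(\<lambda>\<gamma>. f (p \<gamma>)) \<in> trig"
  using assms(2)
  by (induction rule: trig.induct) (auto simp: clinear_simps[OF assms(1)] intro: trig.intros)

lemma trig_translate: "p \<in> trig \<Longrightarrow> (\<lambda>\<gamma>. p (\<gamma> + \<delta>)) \<in> trig"
proof (induction rule: trig.induct)
  case (char_add \<xi> p a)
  then show ?case
    using trig.char_add[of \<xi> "\<lambda>\<gamma>. p (\<gamma> + \<delta>)" "\<xi> \<delta> *\<^sub>C a"]
    by (simp add: dual_groupD(2) scaleC_scaleC)
qed (rule trig.zero)

lemma trig_character:
  assumes "\<eta> \<in> dual_group" "p \<in> trig"
  shows "(\<lambda>\<gamma>. \<eta> \<gamma> *\<^sub>C p \<gamma>) \<in> trig"
  using assms(2)
proof (induction rule: trig.induct)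
  case (char_add \<xi> p a)
  then show ?case
    using trig.char_add[OF dual_group_mult[OF assms(1) char_add(1)] char_add(3)]
    by (simp add: scaleC_add_right scaleC_scaleC)
qed (simp add: trig.zero)

lemma trig_bounded: "p \<in> trig \<Longrightarrow> \<exists>C. \<forall>\<gamma>. norm (p \<gamma>) \<le> C"
proof (induction rule: trig.induct)
  case (char_add \<xi> p a)
  then obtain C where "\<And>\<gamma>. norm (p \<gamma>) \<le> C" by blast
  then have "norm (\<xi> \<gamma> *\<^sub>C a + p \<gamma>) \<le> norm a + C" for \<gamma>
    using norm_triangle_ineq[of "\<xi> \<gamma> *\<^sub>C a" "p \<gamma>"] char_add(1)
    by (simp add: norm_scaleC dual_groupD(1)) (smt (verit))
  then show ?case by blast
qed auto

lemma box_average_scaleC_left: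
  "box_average N ss (\<lambda>\<gamma>. u \<gamma> *\<^sub>C a) \<gamma> = box_average N ss u \<gamma> *\<^sub>C a"
  for a :: "'z::fd_complex_hilbert"
  using box_average_linear[OF bounded_linear.linear[OF bounded_linear_scaleC_left[of a]]] .

text \<open>The order of the quantifiers is the point: all translates share one limit. Translating
  by \<open>\<delta>\<close> multiplies a term by \<open>\<xi> \<delta>\<close>, but only the
  trivial character survives in the limit, and there this factor is 1.\<close>

lemma trig_mean:
  assumes ss: "group_closure (set ss) = UNIV" and "p \<in> trig"
  shows "\<exists>m. \<forall>\<delta>. (\<lambda>N. box_average N ss (\<lambda>\<gamma>. p (\<gamma> + \<delta>)) 0) \<longlonglongrightarrow> m"
  using assms(2)
proof (induction rule: trig.induct)
  case zero
  show ?case by (auto simp: box_average_const)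
next
  case (char_add \<xi> p a)
  then obtain m where m: "\<And>\<delta>. (\<lambda>N. box_average N ss (\<lambda>\<gamma>. p (\<gamma> + \<delta>)) 0) \<longlonglongrightarrow> m" by blast
  let ?c = "if \<xi> = (\<lambda>_. 1) then 1 else 0 :: complex"
  have "(\<lambda>N. box_average N ss (\<lambda>\<gamma>. \<xi> (\<gamma> + \<delta>) *\<^sub>C a + p (\<gamma> + \<delta>)) 0) \<longlonglongrightarrow> ?c *\<^sub>C a + m" for \<delta>
  proof -
    have "(\<lambda>N. box_average N ss \<xi> 0 *\<^sub>C (\<xi> \<delta> *\<^sub>C a)) \<longlonglongrightarrow> ?c *\<^sub>C (\<xi> \<delta> *\<^sub>C a)"
      by (intro bounded_linear.tendsto[OF bounded_linear_scaleC_left]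
          box_average_character_tendsto char_add ss)
    moreover have "?c *\<^sub>C (\<xi> \<delta> *\<^sub>C a) = ?c *\<^sub>C a" by simp
    ultimately have "(\<lambda>N. box_average N ss \<xi> 0 *\<^sub>C (\<xi> \<delta> *\<^sub>C a)) \<longlonglongrightarrow> ?c *\<^sub>C a" by (simp only:)
    from tendsto_add[OF this m[of \<delta>]] show ?thesis
      by (simp only: dual_groupD(2)[OF char_add(1)] scaleC_scaleC[symmetric]
          box_average_add box_average_scaleC_left)
  qed
  then show ?case by blast
qed

text \<open>Total boundedness of the set of translates of \<open>p\<close>, phrased as a finite
  cover of the group by cells on which the translates are uniformly close. It comes from compactness
  of the unit circle, one character at a time.\<close>

lemma trig_almost_periods:
  assumes "p \<in> trig" "\<epsilon> > 0"
  shows "\<exists>P. finite P \<and> \<Union>P = UNIV \<and> (\<forall>A\<in>P. \<forall>\<delta>\<in>A. \<forall>d\<in>A. \<forall>\<gamma>. norm (p (\<gamma> + \<delta>) - p (\<gamma> + d)) < \<epsilon>)"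
  using assms
proof (induction arbitrary: \<epsilon> rule: trig.induct)
  case zero
  then show ?case by (intro exI[of _ "{UNIV}"]) simp
next
  case (char_add \<xi> p a)
  \<comment> \<open>Two values of \<open>\<xi>\<close> in one ball differ by at most
    \<open>2 * e\<close>, which makes the new term contribute at most half of
    \<open>\<epsilon>\<close>. The added 1 covers \<open>a = 0\<close>.\<close>
  define e where "e = \<epsilon> / 4 / (norm a + 1)"
  have "e > 0" using char_add(4) by (simp add: e_def add_nonneg_pos)
  obtain P where P: "finite P" "\<Union>P = UNIV"
    "\<And>A \<delta> d \<gamma>. A \<in> P \<Longrightarrow> \<delta> \<in> A \<Longrightarrow> d \<in> A \<Longrightarrow> norm (p (\<gamma> + \<delta>) - p (\<gamma> + d)) < \<epsilon> / 2"
    using char_add(3)[of "\<epsilon> / 2"] char_add(4) by auto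
  obtain K :: "complex set" where K: "finite K" "sphere 0 1 \<subseteq> (\<Union>z\<in>K. ball z e)"
    using compact_sphere[of "0::complex" 1] \<open>e > 0\<close> unfolding compact_eq_totally_bounded by blast
  \<comment> \<open>The cells for \<open>p\<close> are refined by the preimages under
    \<open>\<xi>\<close> of the finitely many balls covering the circle.\<close>
  define Q where "Q = (\<lambda>(A, z). A \<inter> {\<delta>. \<xi> \<delta> \<in> ball z e}) ` (P \<times> K)"
  have "finite Q" using P(1) K(1) by (simp add: Q_def)
  moreover have "\<Union>Q = UNIV"
  proof (intro equalityI subset_UNIV subsetI)
    fix \<delta>
    have "\<delta> \<in> \<Union>P" by (simp only: P(2) UNIV_I)
    moreover have "\<xi> \<delta> \<in> (\<Union>z\<in>K. ball z e)"
      using dual_groupD(1)[OF char_add(1), of \<delta>] by (intro subsetD[OF K(2)]) simp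
    ultimately show "\<delta> \<in> \<Union>Q" unfolding Q_def by fast
  qed
  moreover have "norm ((\<xi> (\<gamma> + \<delta>) *\<^sub>C a + p (\<gamma> + \<delta>)) - (\<xi> (\<gamma> + d) *\<^sub>C a + p (\<gamma> + d))) < \<epsilon>"
    if B: "B \<in> Q" "\<delta> \<in> B" "d \<in> B" for B \<delta> d \<gamma>
  proof -
    obtain A z where A: "A \<in> P" "\<delta> \<in> A" "d \<in> A" and z: "dist z (\<xi> \<delta>) < e" "dist z (\<xi> d) < e"
      using B unfolding Q_def by auto
    have "norm (\<xi> \<delta> - \<xi> d) \<le> 2 * e"
      using z dist_triangle3[of "\<xi> \<delta>" "\<xi> d" z] by (simp add: dist_norm)
    then have "norm (\<xi> \<delta> - \<xi> d) * norm a \<le> 2 * e * (norm a + 1)"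
      using \<open>e > 0\<close> by (intro mult_mono) auto
    also have "\<dots> = \<epsilon> / 2"
    proof -
      have "norm a + 1 \<noteq> 0" using norm_ge_zero[of a] by linarith
      from iffD1[OF nonzero_eq_divide_eq[OF this] e_def] show ?thesis by linarith
    qed
    also have "norm (\<xi> \<delta> - \<xi> d) * norm a = norm (\<xi> (\<gamma> + \<delta>) *\<^sub>C a - \<xi> (\<gamma> + d) *\<^sub>C a)"
    proof -
      have "\<xi> (\<gamma> + \<delta>) *\<^sub>C a - \<xi> (\<gamma> + d) *\<^sub>C a = (\<xi> \<gamma> * (\<xi> \<delta> - \<xi> d)) *\<^sub>C a"
        by (simp add: dual_groupD(2)[OF char_add(1)] scaleC.scale_left_diff_distrib right_diff_distrib)
      then show ?thesis by (simp add: norm_scaleC norm_mult dual_groupD(1)[OF char_add(1)])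
    qed
    finally have "norm (\<xi> (\<gamma> + \<delta>) *\<^sub>C a - \<xi> (\<gamma> + d) *\<^sub>C a) + norm (p (\<gamma> + \<delta>) - p (\<gamma> + d)) < \<epsilon>"
      using P(3)[OF A, of \<gamma>] by simp
    then show ?thesis
      using norm_diff_triangle_ineq[of "\<xi> (\<gamma> + \<delta>) *\<^sub>C a" "p (\<gamma> + \<delta>)" "\<xi> (\<gamma> + d) *\<^sub>C a" "p (\<gamma> + d)"]
      by linarith
  qed
  ultimately show ?case by (intro exI[of _ Q]) blast
qed

text \<open>The uniform closure of \<open>trig\<close>, matching a single component of a function in
  \<open>almost_periodic\<close>. A pointwise bound replaces the supremum norm, which as a real
  \<open>SUP\<close> is informative only for bounded functions.\<close>

definition ap :: "('g::ab_group_add \<Rightarrow> 'z::fd_complex_hilbert) \<Rightarrow> bool"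
  where "ap g \<longleftrightarrow> (\<forall>\<epsilon>>0. \<exists>p\<in>trig. \<forall>\<gamma>. norm (g \<gamma> - p \<gamma>) < \<epsilon>)"

lemma ap_approx: "ap g \<Longrightarrow> \<epsilon> > 0 \<Longrightarrow> \<exists>p. p \<in> trig \<and> (\<forall>\<gamma>. norm (g \<gamma> - p \<gamma>) < \<epsilon>)"
  unfolding ap_def by blast

lemma ap_add:
  assumes "ap g" "ap h"
  shows "ap (\<lambda>\<gamma>. g \<gamma> + h \<gamma>)"
  unfolding ap_def
proof (intro allI impI)
  fix \<epsilon> :: real assume "\<epsilon> > 0"
  then have "\<epsilon> / 2 > 0" by simp
  obtain p where p: "p \<in> trig" "\<And>\<gamma>. norm (g \<gamma> - p \<gamma>) < \<epsilon> / 2"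
    using ap_approx[OF assms(1) \<open>\<epsilon> / 2 > 0\<close>] by metis
  obtain q where q: "q \<in> trig" "\<And>\<gamma>. norm (h \<gamma> - q \<gamma>) < \<epsilon> / 2"
    using ap_approx[OF assms(2) \<open>\<epsilon> / 2 > 0\<close>] by metis
  have "norm ((g \<gamma> + h \<gamma>) - (p \<gamma> + q \<gamma>)) < \<epsilon>" for \<gamma>
    using norm_diff_triangle_ineq[of "g \<gamma>" "h \<gamma>" "p \<gamma>" "q \<gamma>"] p(2)[of \<gamma>] q(2)[of \<gamma>] by linarith
  then show "\<exists>p\<in>trig. \<forall>\<gamma>. norm (g \<gamma> + h \<gamma> - p \<gamma>) < \<epsilon>"
    by (intro bexI[OF _ trig_add[OF p(1) q(1)]] allI)
qed

lemma ap_clinear: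
  assumes "clinear f" "ap g"
  shows "ap (\<lambda>\<gamma>. f (g \<gamma>))"
  unfolding ap_def
proof (intro allI impI)
  fix \<epsilon> :: real assume "\<epsilon> > 0"
  obtain K where K: "K > 0" "\<And>x. norm (f x) \<le> norm x * K"
    using bounded_linear.pos_bounded[OF clinear_bounded[OF assms(1)]] by blast
  have "\<epsilon> / K > 0" using \<open>\<epsilon> > 0\<close> K(1) by simp
  with assms(2) obtain p where p: "p \<in> trig" "\<And>\<gamma>. norm (g \<gamma> - p \<gamma>) < \<epsilon> / K"
      using ap_approx by metis
  have "norm (f (g \<gamma>) - f (p \<gamma>)) < \<epsilon>" for \<gamma>
  proof -
    have "norm (g \<gamma> - p \<gamma>) * K < \<epsilon>" using p(2)[of \<gamma>] K(1) by (simp add: pos_less_divide_eq)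
    then show ?thesis using K(2)[of "g \<gamma> - p \<gamma>"] by (simp add: clinear_simps[OF assms(1)])
  qed
  then show "\<exists>p\<in>trig. \<forall>\<gamma>. norm (f (g \<gamma>) - p \<gamma>) < \<epsilon>"
    by (intro bexI[OF _ trig_clinear[OF assms(1) p(1)]] allI)
qed

lemma clinear_uminus: "clinear (\<lambda>x::'z::fd_complex_hilbert. - x)"
  by (rule clinearI) simp_all

lemma ap_diff: "ap g \<Longrightarrow> ap h \<Longrightarrow> ap (\<lambda>\<gamma>. g \<gamma> - h \<gamma>)"
  using ap_add[of g "\<lambda>\<gamma>. - h \<gamma>"] ap_clinear[OF clinear_uminus, of h] by simp

lemma ap_translate:
  assumes "ap g"
  shows "ap (\<lambda>\<gamma>. g (\<gamma> + \<delta>))"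
  unfolding ap_def
proof (intro allI impI)
  fix \<epsilon> :: real assume "\<epsilon> > 0"
  with assms obtain p where p: "p \<in> trig" "\<And>\<gamma>. norm (g \<gamma> - p \<gamma>) < \<epsilon>"
    using ap_approx by metis
  then show "\<exists>p\<in>trig. \<forall>\<gamma>. norm (g (\<gamma> + \<delta>) - p \<gamma>) < \<epsilon>"
    by (intro bexI[OF _ trig_translate[OF p(1)]] allI p(2))
qed

lemma ap_character:
  assumes "\<xi> \<in> dual_group" "ap g"
  shows "ap (\<lambda>\<gamma>. \<xi> \<gamma> *\<^sub>C g \<gamma>)"
  unfolding ap_def
proof (intro allI impI)
  fix \<epsilon> :: real assume "\<epsilon> > 0"
  with assms(2) obtain p where p: "p \<in> trig" "\<And>\<gamma>. norm (g \<gamma> - p \<gamma>) < \<epsilon>"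
    using ap_approx by metis
  have "norm (\<xi> \<gamma> *\<^sub>C g \<gamma> - \<xi> \<gamma> *\<^sub>C p \<gamma>) < \<epsilon>" for \<gamma>
    using p(2) by (simp add: norm_scaleC dual_groupD(1)[OF assms(1)] flip: scaleC.scale_right_diff_distrib)
  then show "\<exists>p\<in>trig. \<forall>\<gamma>. norm (\<xi> \<gamma> *\<^sub>C g \<gamma> - p \<gamma>) < \<epsilon>"
    by (intro bexI[OF _ trig_character[OF assms(1) p(1)]] allI)
qed

lemma ap_bounded:
  assumes "ap g"
  obtains C where "C > 0" "\<And>\<gamma>. norm (g \<gamma>) \<le> C"
proof -
  obtain p where p: "p \<in> trig" "\<And>\<gamma>. norm (g \<gamma> - p \<gamma>) < 1"
    using ap_approx[OF assms zero_less_one] by metis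
  obtain C where "\<And>\<gamma>. norm (p \<gamma>) \<le> C" using trig_bounded[OF p(1)] by blast
  then have "norm (g \<gamma>) \<le> \<bar>C\<bar> + 1" for \<gamma>
    using norm_triangle_sub[of "g \<gamma>" "p \<gamma>"] p(2)[of \<gamma>] by (smt (verit))
  then show ?thesis using that[of "\<bar>C\<bar> + 1"] by simp
qed

section \<open>Translation-invariant means and uniqueness of Fourier coefficients\<close>

locale finitely_generated =
  fixes ss :: "'g::ab_group_add list"
  assumes generators: "group_closure (set ss) = UNIV"
begin

abbreviation M :: "nat \<Rightarrow> ('g \<Rightarrow> 'z::real_vector) \<Rightarrow> 'z" where "M N g \<equiv> box_average N ss g 0"

definition mean :: "('g \<Rightarrow> 'z::fd_complex_hilbert) \<Rightarrow> 'z" where "mean g = lim (\<lambda>N. M N g)"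

text \<open>Averaging does not increase a uniform bound, so the averages of every translate of
  \<open>g\<close> eventually stay near the mean of an approximating trigonometric polynomial, which
  is common to all translates. The zero translate then gives the Cauchy property, and comparison
  through the common point gives the same limit for the others.\<close>

lemma ap_mean_exists:
  assumes "ap g"
  shows "\<exists>m. \<forall>\<delta>. (\<lambda>N. M N (\<lambda>\<gamma>. g (\<gamma> + \<delta>))) \<longlonglongrightarrow> m"
proof -
  have close: "\<exists>m. \<forall>\<delta>. \<exists>N0. \<forall>N\<ge>N0. norm (M N (\<lambda>\<gamma>. g (\<gamma> + \<delta>)) - m) < \<epsilon>" if "\<epsilon> > 0" for \<epsilon>
  proof -
    have "\<epsilon> / 2 > 0" using that by simp
    with assms obtain p where p: "p \<in> trig" "\<And>\<gamma>. norm (g \<gamma> - p \<gamma>) < \<epsilon> / 2"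
      using ap_approx by metis
    obtain m where m: "\<And>\<delta>. (\<lambda>N. M N (\<lambda>\<gamma>. p (\<gamma> + \<delta>))) \<longlonglongrightarrow> m"
      using trig_mean[OF generators p(1)] by blast
    have "\<exists>N0. \<forall>N\<ge>N0. norm (M N (\<lambda>\<gamma>. g (\<gamma> + \<delta>)) - m) < \<epsilon>" for \<delta>
    proof -
      obtain N0 where N0: "\<And>N. N \<ge> N0 \<Longrightarrow> norm (M N (\<lambda>\<gamma>. p (\<gamma> + \<delta>)) - m) < \<epsilon> / 2"
        using LIMSEQ_D[OF m \<open>\<epsilon> / 2 > 0\<close>] by blast
      have "norm (M N (\<lambda>\<gamma>. g (\<gamma> + \<delta>) - p (\<gamma> + \<delta>))) \<le> \<epsilon> / 2" for N
        using p(2) by (intro norm_box_average_le) (simp add: less_imp_le)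
      then have "norm (M N (\<lambda>\<gamma>. g (\<gamma> + \<delta>)) - m) < \<epsilon>" if "N \<ge> N0" for N
        using N0[OF that] norm_triangle_ineq[of "M N (\<lambda>\<gamma>. g (\<gamma> + \<delta>) - p (\<gamma> + \<delta>))" "M N (\<lambda>\<gamma>. p (\<gamma> + \<delta>)) - m"]
        by (simp add: box_average_diff) (smt (verit))
      then show ?thesis by blast
    qed
    then show ?thesis by blast
  qed
  have "Cauchy (\<lambda>N. M N g)"
  proof (rule metric_CauchyI)
    fix \<epsilon> :: real assume "\<epsilon> > 0"
    from close[OF half_gt_zero[OF this]] obtain m
      where "\<And>\<delta>. \<exists>N0. \<forall>N\<ge>N0. norm (M N (\<lambda>\<gamma>. g (\<gamma> + \<delta>)) - m) < \<epsilon> / 2"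
      by blast
    from this[of 0] obtain N0 where "dist (M N g) m < \<epsilon> / 2" if "N \<ge> N0" for N
      by (auto simp: dist_norm)
    then show "\<exists>N0. \<forall>N\<ge>N0. \<forall>N'\<ge>N0. dist (M N g) (M N' g) < \<epsilon>"
      by (meson dist_triangle_half_l)
  qed
  then obtain m where m: "(\<lambda>N. M N g) \<longlonglongrightarrow> m"
    using Cauchy_convergent_fd convergent_def by blast
  have "(\<lambda>N. M N (\<lambda>\<gamma>. g (\<gamma> + \<delta>))) \<longlonglongrightarrow> m" for \<delta>
  proof (rule LIMSEQ_I)
    fix \<epsilon> :: real assume "\<epsilon> > 0"
    \<comment> \<open>Three errors occur below: each of the two averages against the common point
      \<open>m'\<close>, and the untranslated average against its limit \<open>m\<close>.\<close>
    then have "\<epsilon> / 4 > 0" by simp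
    from close[OF this] obtain m' where m': "\<And>\<delta>. \<exists>N0. \<forall>N\<ge>N0. norm (M N (\<lambda>\<gamma>. g (\<gamma> + \<delta>)) - m') < \<epsilon> / 4"
      by blast
    obtain N1 where N1: "\<And>N. N \<ge> N1 \<Longrightarrow> norm (M N (\<lambda>\<gamma>. g (\<gamma> + \<delta>)) - m') < \<epsilon> / 4" using m' by blast
    obtain N2 where N2: "\<And>N. N \<ge> N2 \<Longrightarrow> norm (M N g - m') < \<epsilon> / 4" using m'[of 0] by auto
    obtain N3 where N3: "\<And>N. N \<ge> N3 \<Longrightarrow> norm (M N g - m) < \<epsilon> / 4"
      using LIMSEQ_D[OF m \<open>\<epsilon> / 4 > 0\<close>] by blast
    have "norm (M N (\<lambda>\<gamma>. g (\<gamma> + \<delta>)) - m) < \<epsilon>" if "N \<ge> max N1 (max N2 N3)" for N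
    proof -
      have "norm (M N (\<lambda>\<gamma>. g (\<gamma> + \<delta>)) - m) \<le>
          norm (M N (\<lambda>\<gamma>. g (\<gamma> + \<delta>)) - m') + norm (M N g - m') + norm (M N g - m)"
        by norm
      then show ?thesis using N1[of N] N2[of N] N3[of N] that \<open>\<epsilon> > 0\<close> by simp
    qed
    then show "\<exists>N0. \<forall>N\<ge>N0. norm (M N (\<lambda>\<gamma>. g (\<gamma> + \<delta>)) - m) < \<epsilon>" by blast
  qed
  then show ?thesis by blast
qed

lemma mean_tendsto: "ap g \<Longrightarrow> (\<lambda>N. M N g) \<longlonglongrightarrow> mean g"
  and mean_translate: "ap g \<Longrightarrow> mean (\<lambda>\<gamma>. g (\<gamma> + \<delta>)) = mean g"
proof -
  assume "ap g"
  from ap_mean_exists[OF this] obtain m where m: "\<And>\<delta>. (\<lambda>N. M N (\<lambda>\<gamma>. g (\<gamma> + \<delta>))) \<longlonglongrightarrow> m" by blast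
  then have eq: "mean (\<lambda>\<gamma>. g (\<gamma> + \<delta>)) = m" for \<delta> unfolding mean_def by (rule limI)
  show "(\<lambda>N. M N g) \<longlonglongrightarrow> mean g" using m[of 0] eq[of 0] by simp
  show "mean (\<lambda>\<gamma>. g (\<gamma> + \<delta>)) = mean g" using eq[of \<delta>] eq[of 0] by simp
qed

lemma mean_clinear:
  assumes "clinear f" "ap g"
  shows "mean (\<lambda>\<gamma>. f (g \<gamma>)) = f (mean g)"
proof -
  note f = clinear_bounded[OF assms(1)]
  have "(\<lambda>N. M N (\<lambda>\<gamma>. f (g \<gamma>))) \<longlonglongrightarrow> f (mean g)"
    unfolding box_average_linear[OF bounded_linear.linear[OF f]]
    by (rule bounded_linear.tendsto[OF f mean_tendsto[OF assms(2)]])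
  then show ?thesis unfolding mean_def[of "\<lambda>\<gamma>. f (g \<gamma>)"] by (rule limI)
qed

lemma mean_diff:
  assumes "ap g" "ap h"
  shows "mean (\<lambda>\<gamma>. g \<gamma> - h \<gamma>) = mean g - mean h"
proof -
  have "(\<lambda>N. M N (\<lambda>\<gamma>. g \<gamma> - h \<gamma>)) \<longlonglongrightarrow> mean g - mean h"
    unfolding box_average_diff by (intro tendsto_diff mean_tendsto assms)
  then show ?thesis unfolding mean_def[of "\<lambda>\<gamma>. g \<gamma> - h \<gamma>"] by (rule limI)
qed

lemma mean_zero [simp]: "mean (\<lambda>_. 0) = 0"
  unfolding mean_def box_average_const by (rule limI) simp

definition fourier :: "('g \<Rightarrow> 'z::fd_complex_hilbert) \<Rightarrow> ('g \<Rightarrow> complex) \<Rightarrow> 'z"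
  where "fourier g \<xi> = mean (\<lambda>\<gamma>. cnj (\<xi> \<gamma>) *\<^sub>C g \<gamma>)"

lemma ap_cnj_character: "\<xi> \<in> dual_group \<Longrightarrow> ap g \<Longrightarrow> ap (\<lambda>\<gamma>. cnj (\<xi> \<gamma>) *\<^sub>C g \<gamma>)"
  by (rule ap_character[OF dual_group_cnj])

lemma fourier_diff:
  assumes "\<xi> \<in> dual_group" "ap g" "ap h"
  shows "fourier (\<lambda>\<gamma>. g \<gamma> - h \<gamma>) \<xi> = fourier g \<xi> - fourier h \<xi>"
  unfolding fourier_def scaleC.scale_right_diff_distrib
  by (intro mean_diff ap_cnj_character assms)

lemma fourier_clinear:
  assumes "\<xi> \<in> dual_group" "clinear f" "ap g"
  shows "fourier (\<lambda>\<gamma>. f (g \<gamma>)) \<xi> = f (fourier g \<xi>)"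
  unfolding fourier_def
  using mean_clinear[OF assms(2) ap_cnj_character[OF assms(1,3)]]
  by (simp add: clinear_simps[OF assms(2)])

text \<open>\<open>cnj (\<xi> \<gamma>)\<close> equals \<open>\<xi> \<delta>\<close> times
  \<open>cnj (\<xi> (\<gamma> + \<delta>))\<close>. Hence the averaged function is a multiple of a
  translate, and translation does not change the mean.\<close>

lemma fourier_translate:
  fixes g :: "'g \<Rightarrow> 'z::fd_complex_hilbert"
  assumes \<xi>: "\<xi> \<in> dual_group" and g: "ap g"
  shows "fourier (\<lambda>\<gamma>. g (\<gamma> + \<delta>)) \<xi> = \<xi> \<delta> *\<^sub>C fourier g \<xi>"
proof -
  let ?g = "\<lambda>\<gamma>. cnj (\<xi> \<gamma>) *\<^sub>C g \<gamma>"
  have eq: "cnj (\<xi> \<gamma>) *\<^sub>C g (\<gamma> + \<delta>) = \<xi> \<delta> *\<^sub>C ?g (\<gamma> + \<delta>)" for \<gamma>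
  proof -
    have "\<xi> \<delta> * cnj (\<xi> (\<gamma> + \<delta>)) = cnj (\<xi> \<gamma>) * (cnj (\<xi> \<delta>) * \<xi> \<delta>)"
      by (simp only: dual_groupD(2)[OF \<xi>] complex_cnj_mult mult_ac)
    then show ?thesis by (simp only: scaleC_scaleC dual_groupD(4)[OF \<xi>] mult_1_right)
  qed
  have "clinear (\<lambda>x::'z. \<xi> \<delta> *\<^sub>C x)"
    by (rule clinearI) (simp_all add: scaleC_add_right scaleC_scaleC mult.commute)
  from mean_clinear[OF this ap_translate[OF ap_cnj_character[OF \<xi> g]], of \<delta>]
  show ?thesis unfolding fourier_def eq mean_translate[OF ap_cnj_character[OF \<xi> g]] .
qed

lemma fourier_zero [simp]: "fourier (\<lambda>_. 0) \<xi> = 0"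
  by (simp add: fourier_def)

text \<open>Vanishing coefficients make \<open>g\<close> orthogonal in mean to every trigonometric
  polynomial \<open>p\<close>. Splitting the inner product of \<open>g\<close> with itself into
  those of \<open>g - p\<close> and \<open>p\<close> with \<open>g\<close> leaves a uniformly small
  part and a part of mean zero, without a Parseval identity.\<close>

lemma mean_square_tendsto_zero:
  assumes g: "ap g" and zero: "\<And>\<xi>. \<xi> \<in> dual_group \<Longrightarrow> fourier g \<xi> = 0"
  shows "(\<lambda>N. M N (\<lambda>\<gamma>. (norm (g \<gamma>))\<^sup>2)) \<longlonglongrightarrow> 0"
proof -
  have orth: "(\<lambda>N. M N (\<lambda>\<gamma>. cinner (p \<gamma>) (g \<gamma>))) \<longlonglongrightarrow> 0" if "p \<in> trig" for p
    using that
  proof (induction rule: trig.induct)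
    case zero
    show ?case by (simp add: box_average_const)
  next
    case (char_add \<xi> p a)
    note ca = bounded_linear_cinner_right[of a]
    have "(\<lambda>N. cinner a (M N (\<lambda>\<gamma>. cnj (\<xi> \<gamma>) *\<^sub>C g \<gamma>))) \<longlonglongrightarrow> cinner a (fourier g \<xi>)"
      unfolding fourier_def
      by (intro bounded_linear.tendsto[OF ca] mean_tendsto ap_cnj_character char_add g)
    then have "(\<lambda>N. M N (\<lambda>\<gamma>. cinner a (cnj (\<xi> \<gamma>) *\<^sub>C g \<gamma>))) \<longlonglongrightarrow> 0"
      unfolding box_average_linear[OF bounded_linear.linear[OF ca]]
      using assms(2)[OF char_add(1)] by simp
    from tendsto_add_zero[OF this char_add(3)] show ?case
      by (simp add: cinner_add_left cinner_scaleC_left cinner_scaleC_right flip: box_average_add)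
  qed
  obtain C where C: "C > 0" "\<And>\<gamma>. norm (g \<gamma>) \<le> C" using ap_bounded[OF g] by blast
  show ?thesis
  proof (rule LIMSEQ_I)
    fix \<epsilon> :: real assume "\<epsilon> > 0"
    then have "\<epsilon> / 2 / C > 0" "\<epsilon> / 2 > 0" using C(1) by simp_all
    with g obtain p where p: "p \<in> trig" "\<And>\<gamma>. norm (g \<gamma> - p \<gamma>) < \<epsilon> / 2 / C"
      using ap_approx by metis
    obtain N0 where N0: "\<And>N. N \<ge> N0 \<Longrightarrow> norm (M N (\<lambda>\<gamma>. cinner (p \<gamma>) (g \<gamma>))) < \<epsilon> / 2"
      using LIMSEQ_D[OF orth[OF p(1)] \<open>\<epsilon> / 2 > 0\<close>] by auto
    have "norm (M N (\<lambda>\<gamma>. (norm (g \<gamma>))\<^sup>2) - 0) < \<epsilon>" if "N \<ge> N0" for N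
    proof -
      have "norm (cinner (g \<gamma> - p \<gamma>) (g \<gamma>)) \<le> \<epsilon> / 2" for \<gamma>
      proof -
        have "norm (g \<gamma> - p \<gamma>) * norm (g \<gamma>) \<le> \<epsilon> / 2 / C * C"
          using p(2)[of \<gamma>] C \<open>\<epsilon> / 2 / C > 0\<close> by (intro mult_mono) auto
        then show ?thesis using norm_cinner_le[of "g \<gamma> - p \<gamma>" "g \<gamma>"] C(1) by simp
      qed
      then have 1: "norm (M N (\<lambda>\<gamma>. cinner (g \<gamma> - p \<gamma>) (g \<gamma>))) \<le> \<epsilon> / 2"
        by (rule norm_box_average_le)
      have "complex_of_real (M N (\<lambda>\<gamma>. (norm (g \<gamma>))\<^sup>2)) = M N (\<lambda>\<gamma>. complex_of_real ((norm (g \<gamma>))\<^sup>2))"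
        by (rule box_average_linear[OF bounded_linear.linear[OF bounded_linear_of_real], symmetric])
      also have "\<dots> = M N (\<lambda>\<gamma>. cinner (g \<gamma> - p \<gamma>) (g \<gamma>)) + M N (\<lambda>\<gamma>. cinner (p \<gamma>) (g \<gamma>))"
        by (simp only: cinner_self[symmetric] box_average_add[symmetric] cinner_add_left[symmetric]
            diff_add_cancel)
      finally have eq: "complex_of_real (M N (\<lambda>\<gamma>. (norm (g \<gamma>))\<^sup>2)) = \<dots>" .
      have "norm (complex_of_real (M N (\<lambda>\<gamma>. (norm (g \<gamma>))\<^sup>2))) < \<epsilon>"
        unfolding eq using 1 N0[OF that] norm_triangle_ineq[of "M N (\<lambda>\<gamma>. cinner (g \<gamma> - p \<gamma>) (g \<gamma>))"
            "M N (\<lambda>\<gamma>. cinner (p \<gamma>) (g \<gamma>))"] by linarith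
      then show ?thesis by (simp only: norm_of_real diff_zero real_norm_def)
    qed
    then show "\<exists>N0. \<forall>N\<ge>N0. norm (M N (\<lambda>\<gamma>. (norm (g \<gamma>))\<^sup>2) - 0) < \<epsilon>" by blast
  qed
qed

text \<open>A mean-square limit of zero alone would allow non-zero values on a sparse set. Almost
  periodicity excludes this: a large value at one point recurs, so a finite sum of translates of the
  squared norm is bounded below everywhere although its averages tend to zero.\<close>

lemma fourier_uniqueness:
  assumes g: "ap g" and zero: "\<And>\<xi>. \<xi> \<in> dual_group \<Longrightarrow> fourier g \<xi> = 0"
  shows "g \<gamma>\<^sub>0 = 0"
proof (rule ccontr)
  assume "g \<gamma>\<^sub>0 \<noteq> 0"
  define c where "c = norm (g \<gamma>\<^sub>0)"
  have "c > 0" using \<open>g \<gamma>\<^sub>0 \<noteq> 0\<close> by (simp add: c_def)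
  \<comment> \<open>Three errors of this size are subtracted from \<open>c\<close>: two
    approximations of \<open>g\<close> by \<open>p\<close> and one comparison within a cell. This
    leaves \<open>c / 2\<close>.\<close>
  then have "c / 6 > 0" by simp
  with g obtain p where p: "p \<in> trig" "\<And>\<gamma>. norm (g \<gamma> - p \<gamma>) < c / 6"
      using ap_approx by metis
  obtain P where P: "finite P" "\<Union>P = UNIV"
    "\<And>A \<delta> d \<gamma>. A \<in> P \<Longrightarrow> \<delta> \<in> A \<Longrightarrow> d \<in> A \<Longrightarrow> norm (p (\<gamma> + \<delta>) - p (\<gamma> + d)) < c / 6"
    using trig_almost_periods[OF p(1) \<open>c / 6 > 0\<close>] by metis
  \<comment> \<open>One representative per cell. An empty cell contributes an arbitrary element,
    which is harmless because \<open>D\<close> need only be finite and meet every non-empty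
    cell.\<close>
  define D where "D = (\<lambda>A. SOME d. d \<in> A) ` P"
  have "finite D" using P(1) by (simp add: D_def)
  let ?u = "\<lambda>d \<delta>. (norm (g (\<delta> + (\<gamma>\<^sub>0 - d))))\<^sup>2"
  have lower: "(c / 2)\<^sup>2 \<le> (\<Sum>d\<in>D. ?u d \<delta>)" for \<delta>
  proof -
    have "\<delta> \<in> \<Union>P" by (simp only: P(2) UNIV_I)
    then obtain A where A: "A \<in> P" "\<delta> \<in> A" by (rule UnionE)
    define d where "d = (SOME d. d \<in> A)"
    have d: "d \<in> A" "d \<in> D" using A by (auto simp: d_def D_def intro: someI)
    \<comment> \<open>The translates of \<open>p\<close> by \<open>\<delta>\<close> and by
      \<open>d\<close> are compared at \<open>\<gamma>\<^sub>0 - d\<close>, where the second one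
      takes the value of \<open>p\<close> at \<open>\<gamma>\<^sub>0\<close>.\<close>
    have "norm (p (\<delta> + (\<gamma>\<^sub>0 - d)) - p \<gamma>\<^sub>0) < c / 6"
      using P(3)[OF A d(1), of "\<gamma>\<^sub>0 - d"] by (simp add: algebra_simps)
    moreover have "norm (g \<gamma>\<^sub>0) \<le> norm (g (\<delta> + (\<gamma>\<^sub>0 - d))) + norm (g (\<delta> + (\<gamma>\<^sub>0 - d)) - p (\<delta> + (\<gamma>\<^sub>0 - d)))
        + norm (p (\<delta> + (\<gamma>\<^sub>0 - d)) - p \<gamma>\<^sub>0) + norm (g \<gamma>\<^sub>0 - p \<gamma>\<^sub>0)"
      by norm
    ultimately have "c / 2 \<le> norm (g (\<delta> + (\<gamma>\<^sub>0 - d)))"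
      using p(2)[of "\<gamma>\<^sub>0"] p(2)[of "\<delta> + (\<gamma>\<^sub>0 - d)"] unfolding c_def by simp
    then have "(c / 2)\<^sup>2 \<le> ?u d \<delta>" using \<open>c > 0\<close> by (intro power_mono) simp_all
    also have "\<dots> \<le> (\<Sum>d\<in>D. ?u d \<delta>)" using \<open>finite D\<close> d(2) by (intro member_le_sum) auto
    finally show ?thesis .
  qed
  have "(\<lambda>N. M N (?u d)) \<longlonglongrightarrow> 0" for d
  proof (rule mean_square_tendsto_zero[OF ap_translate[OF g]])
    fix \<xi> :: "'g \<Rightarrow> complex" assume "\<xi> \<in> dual_group"
    then show "fourier (\<lambda>\<gamma>. g (\<gamma> + (\<gamma>\<^sub>0 - d))) \<xi> = 0" by (simp add: fourier_translate g zero)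
  qed
  then have "(\<lambda>N. \<Sum>d\<in>D. M N (?u d)) \<longlonglongrightarrow> 0" by (rule tendsto_null_sum)
  moreover have "(c / 2)\<^sup>2 \<le> (\<Sum>d\<in>D. M N (?u d))" for N
    using box_average_mono[of "\<lambda>_. (c / 2)\<^sup>2" "\<lambda>\<delta>. \<Sum>d\<in>D. ?u d \<delta>" N ss 0, OF lower]
    by (simp only: box_average_const box_average_sum)
  ultimately have "(c / 2)\<^sup>2 \<le> 0" by (intro LIMSEQ_le_const) auto
  then show False using \<open>c > 0\<close> by (simp add: power2_eq_square mult_le_0_iff)
qed

end


section \<open>Flexes of gain frameworks\<close>

lemma dsum_norm_ge: "finite I \<Longrightarrow> a \<in> dsum I \<Longrightarrow> norm (a i) \<le> dsum_norm I a"
  unfolding dsum_norm_def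
  by (cases "i \<in> I") (auto simp: dsum_def intro: member_le_L2_set)

lemma linftyI:
  assumes "finite I" "\<And>\<gamma>. f \<gamma> \<in> dsum I" "\<And>\<gamma> i. norm (f \<gamma> i) \<le> C i"
  shows "f \<in> linfty I"
proof -
  have "dsum_norm I (f \<gamma>) \<le> (\<Sum>i\<in>I. C i)" for \<gamma>
  proof -
    have "dsum_norm I (f \<gamma>) \<le> (\<Sum>i\<in>I. norm (f \<gamma> i))"
      unfolding dsum_norm_def by (intro L2_set_le_sum) simp
    also have "\<dots> \<le> (\<Sum>i\<in>I. C i)" by (intro sum_mono assms)
    finally show ?thesis .
  qed
  then have "bdd_above (range (\<lambda>\<gamma>. dsum_norm I (f \<gamma>)))" by (intro bdd_aboveI2)
  then show ?thesis using assms(2) by (simp add: linfty_def)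
qed

lemma linfty_bound:
  assumes "finite I" "f \<in> linfty I"
  shows "norm (f \<gamma> i) \<le> linfty_norm I f"
proof -
  have "norm (f \<gamma> i) \<le> dsum_norm I (f \<gamma>)" using assms by (intro dsum_norm_ge) (auto simp: linfty_def)
  also have "\<dots> \<le> linfty_norm I f"
    unfolding linfty_norm_def using assms(2) by (intro cSUP_upper) (auto simp: linfty_def)
  finally show ?thesis .
qed

lemma linfty_diff:
  assumes "finite I" "f \<in> linfty I" "g \<in> linfty I"
  shows "(\<lambda>\<gamma> i. f \<gamma> i - g \<gamma> i) \<in> linfty I"
proof (rule linftyI[OF assms(1)])
  show "(\<lambda>i. f \<gamma> i - g \<gamma> i) \<in> dsum I" for \<gamma> using assms by (simp add: linfty_def dsum_def)
  show "norm (f \<gamma> i - g \<gamma> i) \<le> linfty_norm I f + linfty_norm I g" for \<gamma> i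
    using norm_triangle_ineq4[of "f \<gamma> i" "g \<gamma> i"] linfty_bound[OF assms(1,2), of \<gamma> i]
      linfty_bound[OF assms(1,3), of \<gamma> i] by linarith
qed

lemma trig_polys_linfty:
  assumes "finite I" "p \<in> trig_polys I"
  shows "p \<in> linfty I"
proof -
  obtain n \<xi> a where p: "p = (\<lambda>\<gamma> i. \<Sum>k<(n::nat). \<xi> k \<gamma> *\<^sub>C a k i)"
    and \<xi>: "\<And>k. k < n \<Longrightarrow> \<xi> k \<in> dual_group \<and> a k \<in> dsum I"
    using assms(2) unfolding trig_polys_def by blast
  show ?thesis
  proof (rule linftyI[OF assms(1)])
    show "p \<gamma> \<in> dsum I" for \<gamma> using \<xi> by (auto simp: p dsum_def intro!: sum.neutral)
    show "norm (p \<gamma> i) \<le> (\<Sum>k<n. norm (a k i))" for \<gamma> i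
      unfolding p using \<xi>
      by (intro order_trans[OF norm_sum] sum_mono) (simp add: norm_scaleC dual_groupD(1))
  qed
qed

lemma almost_periodic_component:
  assumes I: "finite I" and h: "h \<in> almost_periodic I"
  shows "ap (\<lambda>\<gamma>. h \<gamma> i)"
  unfolding ap_def
proof (intro allI impI)
  fix \<epsilon> :: real assume "\<epsilon> > 0"
  then obtain p where p: "p \<in> trig_polys I" "linfty_norm I (\<lambda>\<gamma> i. h \<gamma> i - p \<gamma> i) < \<epsilon>"
    using h unfolding almost_periodic_def by blast
  \<comment> \<open>Boundedness of the difference has to come first: only then does the real
    supremum in \<open>linfty_norm\<close> dominate its values.\<close>
  have "(\<lambda>\<gamma> i. h \<gamma> i - p \<gamma> i) \<in> linfty I"
    using h trig_polys_linfty[OF I p(1)] by (intro linfty_diff I) (simp_all add: almost_periodic_def)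
  then have close: "norm (h \<gamma> i - p \<gamma> i) < \<epsilon>" for \<gamma>
    using linfty_bound[OF I, of "\<lambda>\<gamma> i. h \<gamma> i - p \<gamma> i" \<gamma> i] p(2) by linarith
  obtain n \<xi> a where "p = (\<lambda>\<gamma> i. \<Sum>k<(n::nat). \<xi> k \<gamma> *\<^sub>C a k i)" "\<And>k. k < n \<Longrightarrow> \<xi> k \<in> dual_group"
    using p(1) unfolding trig_polys_def by blast
  then have "(\<lambda>\<gamma>. p \<gamma> i) \<in> trig" by (simp add: trig_sum)
  then show "\<exists>q\<in>trig. \<forall>\<gamma>. norm (h \<gamma> i - q \<gamma>) < \<epsilon>"
    by (rule bexI[rotated]) (simp add: close)
qed

lemma character_almost_periodic:
  assumes I: "finite I" and "\<xi> \<in> dual_group" "a \<in> dsum I"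
  shows "(\<lambda>\<gamma> i. \<xi> \<gamma> *\<^sub>C a i) \<in> almost_periodic I"
proof -
  let ?p = "\<lambda>\<gamma> i. \<xi> \<gamma> *\<^sub>C a i"
  have p: "?p \<in> trig_polys I"
    unfolding trig_polys_def using assms
    by (intro CollectI exI[of _ "1::nat"] exI[of _ "\<lambda>_. \<xi>"] exI[of _ "\<lambda>_. a"]) simp
  have "linfty_norm I (\<lambda>\<gamma> i. ?p \<gamma> i - ?p \<gamma> i) < \<epsilon>" if "\<epsilon> > 0" for \<epsilon>
    using that by (simp add: linfty_norm_def dsum_norm_def L2_set_def)
  then show ?thesis
    unfolding almost_periodic_def
    by (intro CollectI conjI allI impI bexI[OF _ p] trig_polys_linfty[OF I p])
qed

section \<open>Gain frameworks with a fixed list of group generators\<close>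

locale gain_framework = isometric_action "sym_hom \<G>" + finitely_generated ss
  for \<G> :: "('v, 'e, 'g::ab_group_add, 'x::fd_complex_hilbert, 'y::fd_complex_hilbert) gain_framework"
    and ss :: "'g list" +
  assumes framework: "is_gain_framework \<G>"
begin

abbreviation V where "V \<equiv> verts (graph \<G>)"
abbreviation E where "E \<equiv> arcs (graph \<G>)"
abbreviation src where "src \<equiv> tail (graph \<G>)"
abbreviation trg where "trg \<equiv> head (graph \<G>)"

lemma finite_V: "finite V" and V_nonempty: "V \<noteq> {}"
  and src_V: "e \<in> E \<Longrightarrow> src e \<in> V" and trg_V: "e \<in> E \<Longrightarrow> trg e \<in> V"
  and edge_clinear: "e \<in> E \<Longrightarrow> clinear (edge_map \<G> e)"
proof -
  have "fin_digraph (graph \<G>)" using framework by (simp add: is_gain_framework_def)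
  then interpret fin_digraph "graph \<G>" .
  show "finite V" by simp
  show "e \<in> E \<Longrightarrow> src e \<in> V" "e \<in> E \<Longrightarrow> trg e \<in> V" by simp_all
  show "V \<noteq> {}" "e \<in> E \<Longrightarrow> clinear (edge_map \<G> e)"
    using framework by (simp_all add: is_gain_framework_def)
qed

lemma twist_linfty:
  assumes "h \<in> linfty V"
  shows "twist \<G> h \<in> linfty V"
proof -
  have "twist \<G> h \<gamma> \<in> dsum V" for \<gamma>
    using assms by (simp add: linfty_def dsum_def twist_def T_simps)
  moreover have "dsum_norm V (twist \<G> h \<gamma>) = dsum_norm V (h \<gamma>)" for \<gamma>
    by (simp add: dsum_norm_def twist_def)
  ultimately show ?thesis using assms by (simp add: linfty_def)
qed

text \<open>The factor at \<open>- \<gamma>\<close> in the gain operator cancels the twist at the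
  source and reduces the twist at the range to that of the gain. No \<open>\<gamma>\<close> remains
  in the coefficients, which is what lets Fourier coefficients be taken edge by edge.\<close>

lemma gain_op_twist:
  "e \<in> E \<Longrightarrow> gain_op \<G> (twist \<G> h) \<gamma> e =
    edge_map \<G> e (h \<gamma> (src e) - T (gain \<G> e) (h (\<gamma> + gain \<G> e) (trg e)))"
  by (simp add: gain_op_def twist_def T_simps T_add)

lemma sym_vector_twist: "sym_vector \<G> \<xi> a = twist \<G> (\<lambda>\<gamma> v. \<xi> \<gamma> *\<^sub>C a v)"
  by (simp add: sym_vector_def twist_def T_simps)

lemma gain_op_sym_vector:
  assumes \<xi>: "\<xi> \<in> dual_group"
  shows "gain_op \<G> (sym_vector \<G> \<xi> a) \<gamma> e = \<xi> \<gamma> *\<^sub>C orbit_matrix \<G> \<xi> a e"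
proof (cases "e \<in> E")
  case True
  then show ?thesis
    unfolding sym_vector_twist gain_op_twist[OF True]
    by (simp add: orbit_matrix_def clinear_simps[OF edge_clinear[OF True]] T_simps
        dual_groupD(2)[OF \<xi>] scaleC.scale_right_diff_distrib scaleC_scaleC)
next
  case False
  then show ?thesis by (simp add: gain_op_def orbit_matrix_def)
qed

lemma sym_vector_flex:
  assumes \<xi>: "\<xi> \<in> dual_group" and a: "a \<in> dsum V" and ker: "orbit_matrix \<G> \<xi> a = (\<lambda>_. 0)"
  shows "sym_flex \<G> \<xi> (sym_vector \<G> \<xi> a)"
proof -
  have "(\<lambda>\<gamma> v. \<xi> \<gamma> *\<^sub>C a v) \<in> linfty V"
    using character_almost_periodic[OF finite_V \<xi> a] by (simp add: almost_periodic_def)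
  then have "sym_vector \<G> \<xi> a \<in> linfty V" unfolding sym_vector_twist by (rule twist_linfty)
  moreover have "gain_op \<G> (sym_vector \<G> \<xi> a) = (\<lambda>_ _. 0)"
    by (intro ext) (simp add: gain_op_sym_vector[OF \<xi>] ker)
  ultimately show ?thesis unfolding sym_flex_def bounded_flex_def using a by blast
qed

lemma sym_flex_twisted_ap:
  assumes \<xi>: "\<xi> \<in> dual_group" and f: "sym_flex \<G> \<xi> f"
  shows "twisted_ap_flex \<G> f"
proof -
  obtain a where a: "a \<in> dsum V" "f = sym_vector \<G> \<xi> a" and fl: "bounded_flex \<G> f"
    using f unfolding sym_flex_def by blast
  show ?thesis
    unfolding twisted_ap_flex_def using character_almost_periodic[OF finite_V \<xi> a(1)] a(2) fl
    by (auto simp: sym_vector_twist)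
qed

text \<open>Evaluation at the neutral element identifies the constant value with each
  \<open>a v\<close>; substituting this back gives the fixed-vector equation.\<close>

lemma sym_vector_translation:
  assumes \<xi>: "\<xi> \<in> dual_group" and "is_translation \<G> (sym_vector \<G> \<xi> a)"
  obtains b where "\<And>v. v \<in> V \<Longrightarrow> a v = b" "\<And>\<gamma>. \<xi> \<gamma> *\<^sub>C T \<gamma> b = b"
proof -
  obtain b where b: "\<And>\<gamma> v. v \<in> V \<Longrightarrow> \<xi> \<gamma> *\<^sub>C T \<gamma> (a v) = b"
    using assms(2) unfolding is_translation_def sym_vector_def by blast
  have eq: "a v = b" if "v \<in> V" for v using b[OF that, of 0] by (simp add: dual_groupD(3)[OF \<xi>])
  obtain v where "v \<in> V" using V_nonempty by blast
  have "\<xi> \<gamma> *\<^sub>C T \<gamma> b = b" for \<gamma> using b[OF \<open>v \<in> V\<close>, of \<gamma>] eq[OF \<open>v \<in> V\<close>] by simp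
  with eq show ?thesis by (rule that)
qed

text \<open>The fixed vector \<open>b\<close> placed at every vertex is killed on each edge before
  the edge map is applied. It is non-zero since there is at least one vertex.\<close>

lemma joint_spectral_points_subset:
  assumes \<xi>: "\<xi> \<in> joint_spectral_points (sym_hom \<G>)"
  shows "\<xi> \<in> RUM_spectrum \<G>"
proof -
  obtain b where \<xi>': "\<xi> \<in> dual_group" and b: "b \<noteq> 0" and eig: "\<forall>\<gamma>. \<xi> \<gamma> *\<^sub>C T \<gamma> b = b"
    using \<xi> unfolding joint_spectral_points_eq[OF finite_set generators]
    by (elim CollectE conjE exE) (rule that)
  define a where "a = (\<lambda>v. if v \<in> V then b else 0)"
  have "a \<in> dsum V" by (simp add: a_def dsum_def)
  moreover have "orbit_matrix \<G> \<xi> a = (\<lambda>_. 0)"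
  proof
    fix e
    show "orbit_matrix \<G> \<xi> a e = 0"
      using eig by (simp add: orbit_matrix_def a_def src_V trg_V clinear_simps[OF edge_clinear])
  qed
  moreover have "a \<noteq> (\<lambda>_. 0)"
  proof -
    obtain v where "v \<in> V" using V_nonempty by blast
    then have "a v \<noteq> 0" using b by (simp add: a_def)
    then show ?thesis by auto
  qed
  ultimately show ?thesis unfolding RUM_spectrum_def using \<xi>' by blast
qed

text \<open>Taking the coefficient at \<open>\<xi>\<close> commutes with the linear maps in the edge
  equation and turns translation by the gain into the factor \<open>\<xi>\<close> of the gain, which
  is exactly the orbit matrix.\<close>

lemma fourier_flex:
  assumes h: "h \<in> almost_periodic V" and flex: "bounded_flex \<G> (twist \<G> h)" and \<xi>: "\<xi> \<in> dual_group"
  shows "(\<lambda>v. fourier (\<lambda>\<gamma>. h \<gamma> v) \<xi>) \<in> dsum V"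
    "orbit_matrix \<G> \<xi> (\<lambda>v. fourier (\<lambda>\<gamma>. h \<gamma> v) \<xi>) = (\<lambda>_. 0)"
proof -
  note ap = almost_periodic_component[OF finite_V h]
  have "h \<gamma> v = 0" if "v \<notin> V" for \<gamma> v
    using h that by (simp add: almost_periodic_def linfty_def dsum_def)
  then show "(\<lambda>v. fourier (\<lambda>\<gamma>. h \<gamma> v) \<xi>) \<in> dsum V" by (simp add: dsum_def)
  show "orbit_matrix \<G> \<xi> (\<lambda>v. fourier (\<lambda>\<gamma>. h \<gamma> v) \<xi>) = (\<lambda>_. 0)"
  proof
    fix e
    show "orbit_matrix \<G> \<xi> (\<lambda>v. fourier (\<lambda>\<gamma>. h \<gamma> v) \<xi>) e = 0"
    proof (cases "e \<in> E")
      case True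
      let ?m = "gain \<G> e" and ?hs = "\<lambda>\<gamma>. h \<gamma> (src e)" and ?hr = "\<lambda>\<gamma>. h \<gamma> (trg e)"
      let ?d = "\<lambda>\<gamma>. ?hs \<gamma> - T ?m (?hr (\<gamma> + ?m))"
      note ap_tr = ap_translate[OF ap[of "trg e"], of ?m]
      note ap_T = ap_clinear[OF clinear_T[of ?m] ap_tr]
      have zero: "edge_map \<G> e (?d \<gamma>) = 0" for \<gamma>
        using flex gain_op_twist[OF True, of h \<gamma>] by (simp add: bounded_flex_def)
      have "edge_map \<G> e (fourier ?d \<xi>) = fourier (\<lambda>\<gamma>. edge_map \<G> e (?d \<gamma>)) \<xi>"
        by (rule fourier_clinear[OF \<xi> edge_clinear[OF True] ap_diff[OF ap ap_T], symmetric])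
      also have "\<dots> = 0" unfolding zero by (rule fourier_zero)
      also have "fourier ?d \<xi> = fourier ?hs \<xi> - \<xi> ?m *\<^sub>C T ?m (fourier ?hr \<xi>)"
        by (simp only: fourier_diff[OF \<xi> ap ap_T] fourier_clinear[OF \<xi> clinear_T ap_tr]
            fourier_translate[OF \<xi> ap] T_simps)
      finally show ?thesis using True by (simp add: orbit_matrix_def)
    qed (simp add: orbit_matrix_def)
  qed
qed

text \<open>Every Fourier coefficient of \<open>h\<close> is a constant \<open>b\<close> with \<open>\<xi> \<gamma> *\<^sub>C T \<gamma> b = b\<close>. Hence all
  Fourier coefficients of \<open>\<gamma> \<mapsto> h \<gamma> v - h \<gamma> w\<close> and of \<open>\<gamma> \<mapsto> T \<delta> (h (\<gamma> + \<delta>) v) - h \<gamma> v\<close> vanish.\<close>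

lemma twisted_ap_flex_translation:
  assumes sym: "\<And>\<xi> f. \<xi> \<in> dual_group \<Longrightarrow> sym_flex \<G> \<xi> f \<Longrightarrow> f \<noteq> (\<lambda>_ _. 0) \<Longrightarrow> is_translation \<G> f"
    and f: "twisted_ap_flex \<G> f"
  shows "is_translation \<G> f"
proof -
  obtain h where h: "h \<in> almost_periodic V" and fh: "f = twist \<G> h" and flex: "bounded_flex \<G> f"
    using f unfolding twisted_ap_flex_def by blast
  note ap = almost_periodic_component[OF finite_V h]
  have coeff: "\<exists>b. (\<forall>v\<in>V. fourier (\<lambda>\<gamma>. h \<gamma> v) \<xi> = b) \<and> (\<forall>\<gamma>. \<xi> \<gamma> *\<^sub>C T \<gamma> b = b)"
    if \<xi>: "\<xi> \<in> dual_group" for \<xi>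
  proof -
    let ?a = "\<lambda>v. fourier (\<lambda>\<gamma>. h \<gamma> v) \<xi>"
    have flex_a: "sym_flex \<G> \<xi> (sym_vector \<G> \<xi> ?a)"
      using fourier_flex[OF h flex[unfolded fh] \<xi>] by (rule sym_vector_flex[OF \<xi>])
    have "is_translation \<G> (sym_vector \<G> \<xi> ?a)"
    \<comment> \<open>The hypothesis \<open>sym\<close> speaks of non-zero flexes only; a vanishing
      symmetric vector is the translation by 0.\<close>
    proof (cases "sym_vector \<G> \<xi> ?a = (\<lambda>_ _. 0)")
      case True
      then show ?thesis using flex_a by (auto simp: is_translation_def sym_flex_def bounded_flex_def)
    next
      case False
      then show ?thesis by (rule sym[OF \<xi> flex_a])
    qed
    from sym_vector_translation[OF \<xi> this] obtain b
      where "\<And>v. v \<in> V \<Longrightarrow> ?a v = b" "\<And>\<gamma>. \<xi> \<gamma> *\<^sub>C T \<gamma> b = b" by metis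
    then show ?thesis by (intro exI[of _ b]) simp
  qed
  have same: "h \<gamma> v - h \<gamma> w = 0" if "v \<in> V" "w \<in> V" for \<gamma> v w
  proof (rule fourier_uniqueness[OF ap_diff[OF ap ap]])
    fix \<xi> :: "'g \<Rightarrow> complex" assume \<xi>: "\<xi> \<in> dual_group"
    show "fourier (\<lambda>\<gamma>. h \<gamma> v - h \<gamma> w) \<xi> = 0"
      using coeff[OF \<xi>] that by (auto simp: fourier_diff[OF \<xi> ap ap])
  qed
  have const: "T \<delta> (h (\<gamma> + \<delta>) v) - h \<gamma> v = 0" if "v \<in> V" for \<gamma> \<delta> v
  proof (rule fourier_uniqueness[of "\<lambda>\<gamma>. T \<delta> (h (\<gamma> + \<delta>) v) - h \<gamma> v"])
    note ap_tr = ap_translate[OF ap[of v], of \<delta>]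
    note ap_T = ap_clinear[OF clinear_T[of \<delta>] ap_tr]
    show "ap (\<lambda>\<gamma>. T \<delta> (h (\<gamma> + \<delta>) v) - h \<gamma> v)" by (rule ap_diff[OF ap_T ap])
    fix \<xi> :: "'g \<Rightarrow> complex" assume \<xi>: "\<xi> \<in> dual_group"
    have "fourier (\<lambda>\<gamma>. T \<delta> (h (\<gamma> + \<delta>) v) - h \<gamma> v) \<xi> =
        \<xi> \<delta> *\<^sub>C T \<delta> (fourier (\<lambda>\<gamma>. h \<gamma> v) \<xi>) - fourier (\<lambda>\<gamma>. h \<gamma> v) \<xi>"
      by (simp only: fourier_diff[OF \<xi> ap_T ap] fourier_clinear[OF \<xi> clinear_T ap_tr]
          fourier_translate[OF \<xi> ap] T_simps)
    also have "\<dots> = 0" using coeff[OF \<xi>] that by auto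
    finally show "fourier (\<lambda>\<gamma>. T \<delta> (h (\<gamma> + \<delta>) v) - h \<gamma> v) \<xi> = 0" .
  qed
  obtain w where w: "w \<in> V" using V_nonempty by blast
  \<comment> \<open>Base point 0 and shift \<open>\<gamma>\<close> in \<open>const\<close> say that
    the twisted value \<open>T \<gamma> (h \<gamma> v)\<close> equals \<open>h 0 v\<close>;
    \<open>same\<close> then removes the dependence on the vertex.\<close>
  have "f \<gamma> v = h 0 w" if "v \<in> V" for \<gamma> v
    using const[OF that, of \<gamma> 0] same[OF that w, of 0] by (simp add: fh twist_def)
  then show ?thesis using flex unfolding is_translation_def bounded_flex_def by blast
qed

lemma translation_characterization:
  "(\<forall>f. twisted_ap_flex \<G> f \<longrightarrow> is_translation \<G> f) \<longleftrightarrow>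
    (RUM_spectrum \<G> = joint_spectral_points (sym_hom \<G>) \<and>
     (\<forall>\<xi>\<in>dual_group. \<forall>f. sym_flex \<G> \<xi> f \<and> f \<noteq> (\<lambda>_ _. 0) \<longrightarrow> is_translation \<G> f))"
proof
  assume trans: "\<forall>f. twisted_ap_flex \<G> f \<longrightarrow> is_translation \<G> f"
  have "\<xi> \<in> joint_spectral_points (sym_hom \<G>)" if "\<xi> \<in> RUM_spectrum \<G>" for \<xi>
  proof -
    have \<xi>: "\<xi> \<in> dual_group" using that by (simp add: RUM_spectrum_def)
    \<comment> \<open>The spectrum is defined by the kernel differing from the singleton of zero.
      Knowing that zero lies in the kernel turns this into a non-zero kernel vector.\<close>
    have "orbit_matrix \<G> \<xi> (\<lambda>_. 0) = (\<lambda>_. 0)"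
      by (auto simp: orbit_matrix_def T_simps clinear_simps[OF edge_clinear])
    then have zero: "(\<lambda>_. 0) \<in> {a \<in> dsum V. orbit_matrix \<G> \<xi> a = (\<lambda>_. 0)}" by (simp add: dsum_def)
    have nonzero: "{a \<in> dsum V. orbit_matrix \<G> \<xi> a = (\<lambda>_. 0)} \<noteq> {\<lambda>_. 0}"
      using that unfolding RUM_spectrum_def mem_Collect_eq by (rule conjunct2)
    have "\<exists>a\<in>S. a \<noteq> z" if "z \<in> S" "S \<noteq> {z}" for S and z :: "'v \<Rightarrow> 'x"
      using that by blast
    from this[OF zero nonzero] obtain a
      where "a \<in> {a \<in> dsum V. orbit_matrix \<G> \<xi> a = (\<lambda>_. 0)}" "a \<noteq> (\<lambda>_. 0)"
      by (rule bexE)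
    then have a: "a \<in> dsum V" "orbit_matrix \<G> \<xi> a = (\<lambda>_. 0)" "a \<noteq> (\<lambda>_. 0)"
      by simp_all
    have "is_translation \<G> (sym_vector \<G> \<xi> a)"
      using trans sym_flex_twisted_ap[OF \<xi> sym_vector_flex[OF \<xi> a(1,2)]] by blast
    from sym_vector_translation[OF \<xi> this] obtain b
      where b: "\<And>v. v \<in> V \<Longrightarrow> a v = b" "\<And>\<gamma>. \<xi> \<gamma> *\<^sub>C T \<gamma> b = b" by metis
    \<comment> \<open>A kernel vector vanishes off the vertex set and equals \<open>b\<close> on it,
      so \<open>b = 0\<close> would make it zero.\<close>
    have "b \<noteq> 0"
    proof
      assume "b = 0"
      then have "a v = 0" for v using a(1) b(1) by (cases "v \<in> V") (auto simp: dsum_def)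
      then show False using a(3) by auto
    qed
    then show ?thesis
      unfolding joint_spectral_points_eq[OF finite_set generators]
      by (intro CollectI conjI exI[of _ b] allI \<xi> b(2))
  qed
  then show "RUM_spectrum \<G> = joint_spectral_points (sym_hom \<G>) \<and>
     (\<forall>\<xi>\<in>dual_group. \<forall>f. sym_flex \<G> \<xi> f \<and> f \<noteq> (\<lambda>_ _. 0) \<longrightarrow> is_translation \<G> f)"
    using trans sym_flex_twisted_ap joint_spectral_points_subset by blast
next
  assume "RUM_spectrum \<G> = joint_spectral_points (sym_hom \<G>) \<and>
     (\<forall>\<xi>\<in>dual_group. \<forall>f. sym_flex \<G> \<xi> f \<and> f \<noteq> (\<lambda>_ _. 0) \<longrightarrow> is_translation \<G> f)"
  then show "\<forall>f. twisted_ap_flex \<G> f \<longrightarrow> is_translation \<G> f"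
    using twisted_ap_flex_translation by blast
qed

end

theorem theorem4p9:
  fixes \<G> :: "('v, 'e, 'g::ab_group_add, 'x::fd_complex_hilbert, 'y::fd_complex_hilbert) gain_framework"
  assumes "\<exists>S::'g set. finite S \<and> group_closure S = UNIV"
    and "is_gain_framework \<G>"
  shows "(\<forall>f. twisted_ap_flex \<G> f \<longrightarrow> is_translation \<G> f) \<longleftrightarrow>
    (RUM_spectrum \<G> = joint_spectral_points (sym_hom \<G>) \<and>
     (\<forall>\<xi>\<in>dual_group. \<forall>f. sym_flex \<G> \<xi> f \<and> f \<noteq> (\<lambda>_ _. 0) \<longrightarrow> is_translation \<G> f))"
proof -
  obtain ss :: "'g list" where "group_closure (set ss) = UNIV"
    using assms(1) finite_list by metis
  then interpret gain_framework \<G> ss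
    using assms(2) by unfold_locales (simp_all add: is_gain_framework_def)
  show ?thesis by (rule translation_characterization)
qed

end
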